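(* Let $\mathbb{R}^n$ and $\mathbb{R}^m$ be equipped with Euclidean norms and assume that $m>1$. There exists a measure $\mu\in\mathcal{W}(\mathbb{R}^n,\mathbb{R}^m)$, absolutely continuous with respect to the Lebesgue measure $\lambda$ on $\mathbb{R}^n$, for which there exists a transport set $A$ associated with an optimal potential of $\mu$ such that $\mu(A)\neq 0$. In particular, there is no optimal transport $\pi$ for $\mu$ such that $\mathrm{P}_1\|\pi\|\ll\lambda$ and $\mathrm{P}_2\|\pi\|\ll\lambda$.
   Context: $\langle\cdot,\cdot\rangle$ is the standard scalar product. For an $\mathbb{R}^m$-valued Borel measure $\mu$, $\|\mu\|$ denotes its total variation measure, and $\int\langle u,d\mu\rangle=\sum_{i=1}^m\int u_i\,d\mu_i$. For a (real- or $\mathbb{R}^m$-valued) Borel measure $\pi$ on $\mathbb{R}^n\times \mathbb{R}^n$, its marginals are $\mathrm{P}_1\pi(B)=\pi(B\times \mathbb{R}^n)$ and $\mathrm{P}_2\pi(B)=\pi(\mathbb{R}^n\times B)$ for Borel $B\subset\mathbb{R}^n$. $\Gamma(\mu)$ is the set of all $\mathbb{R}^m$-valued Borel measures $\pi$ on $\mathbb{R}^n\times\mathbb{R}^n$ with $\mathrm{P}_1\pi-\mathrm{P}_2\pi=\mu$. The Wasserstein space $\mathcal{W}(\mathbb{R}^n,\mathbb{R}^m)$ is the space of all $\mathbb{R}^m$-valued Borel measures $\mu$ on $\mathbb{R}^n$ with $\mu(\mathbb{R}^n)=0$ and $\int \|x-x_0\|\,d\|\mu\|(x)<\infty$ for some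 $x_0\in\mathbb{R}^n$, with the norm $\|\mu\|_{\mathcal{W}(\mathbb{R}^n,\mathbb{R}^m)}=\inf\{\int\|x-y\|\,d\|\pi\|(x,y)\mid \pi\in\Gamma(\mu)\}$. A $1$-Lipschitz map $u\colon \mathbb{R}^n\to\mathbb{R}^m$ is an optimal potential of $\mu$ if $\int\langle u,d\mu\rangle=\sup\{\int\langle v,d\mu\rangle\mid v\colon \mathbb{R}^n\to\mathbb{R}^m\text{ is }1\text{-Lipschitz}\}$. A measure $\pi\in\Gamma(\mu)$ is an optimal transport for $\mu$ if $\|\mu\|_{\mathcal{W}(\mathbb{R}^n,\mathbb{R}^m)}=\int\|x-y\|\,d\|\pi\|(x,y)$. A leaf of a $1$-Lipschitz map $u\colon\mathbb{R}^n\to\mathbb{R}^m$ is a set $\mathcal{S}\subset\mathbb{R}^n$, maximal with respect to inclusion, such that $u|_{\mathcal{S}}$ is an isometry, i.e. $\|u(x)-u(y)\|=\|x-y\|$ for all $x,y\in\mathcal{S}$. A Borel set $A\subset\mathbb{R}^n$ is a transport set associated with $u$ if: whenever $x\in A$ is contained in a unique leaf of $u$ and $y\in\mathbb{R}^n$ satisfies $\|u(x)-u(y)\|=\|x-y\|$, then $y\in A$. *)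

theory Defs
  imports "HOL-Analysis.Analysis"
begin

text \<open>
  A vector measure is represented by a set function of which only the values on Borel sets matter:
  every notion below depends on these values alone.
\<close>

definition vector_measure :: "('a::topological_space set \<Rightarrow> 'b::real_normed_vector) \<Rightarrow> bool" where
  "vector_measure \<mu> \<longleftrightarrow> \<mu> {} = 0 \<and>
     (\<forall>A :: nat \<Rightarrow> 'a set. range A \<subseteq> sets borel \<longrightarrow> disjoint_family A \<longrightarrow>
        (\<lambda>i. \<mu> (A i)) sums \<mu> (\<Union>i. A i))"

definition total_variation ::
    "('a::topological_space set \<Rightarrow> 'b::real_normed_vector) \<Rightarrow> 'a measure" where
  "total_variation \<mu> = measure_of UNIV (sets borel)
     (\<lambda>A. SUP P \<in> {P. finite P \<and> disjoint P \<and> P \<subseteq> sets borel \<and> \<Union>P = A}.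
        \<Sum>B\<in>P. ennreal (norm (\<mu> B)))"

text \<open>
  The integral against a real-valued (signed) measure is taken through its Jordan decomposition:
  the positive part of \<open>\<nu>\<close> is \<open>A \<mapsto> sup {\<nu> B | B \<subseteq> A Borel}\<close>, and the negative part is the
  positive part of \<open>- \<nu>\<close>. Since \<open>ennreal\<close> sends negative numbers to \<open>0\<close> and \<open>\<nu> {} = 0\<close>, the
  coercion below does not change the supremum.
\<close>

definition positive_variation :: "('a::topological_space set \<Rightarrow> real) \<Rightarrow> 'a measure" where
  "positive_variation \<nu> = measure_of UNIV (sets borel)
     (\<lambda>A. SUP B \<in> {B \<in> sets borel. B \<subseteq> A}. ennreal (\<nu> B))"

definition signed_integral :: "('a::topological_space set \<Rightarrow> real) \<Rightarrow> ('a \<Rightarrow> real) \<Rightarrow> real" where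
  "signed_integral \<nu> f =
     integral\<^sup>L (positive_variation \<nu>) f - integral\<^sup>L (positive_variation (\<lambda>B. - \<nu> B)) f"

definition vector_integral ::
    "('a::topological_space set \<Rightarrow> real ^ 'm) \<Rightarrow> ('a \<Rightarrow> real ^ 'm) \<Rightarrow> real" where
  "vector_integral \<mu> u = (\<Sum>i\<in>UNIV. signed_integral (\<lambda>B. \<mu> B $ i) (\<lambda>x. u x $ i))"

text \<open>
  Marginals of vector measures; the marginals of a nonnegative measure \<open>M\<close> on the product are
  \<open>distr M borel fst\<close> and \<open>distr M borel snd\<close>.
\<close>

definition marginal1 :: "(('a \<times> 'a) set \<Rightarrow> 'b) \<Rightarrow> 'a set \<Rightarrow> 'b" where
  "marginal1 \<pi> B = \<pi> (B \<times> UNIV)"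

definition marginal2 :: "(('a \<times> 'a) set \<Rightarrow> 'b) \<Rightarrow> 'a set \<Rightarrow> 'b" where
  "marginal2 \<pi> B = \<pi> (UNIV \<times> B)"

definition transports ::
    "((real ^ 'n) set \<Rightarrow> real ^ 'm) \<Rightarrow> (((real ^ 'n) \<times> (real ^ 'n)) set \<Rightarrow> real ^ 'm) set" where
  "transports \<mu> = {\<pi>. vector_measure \<pi> \<and>
     (\<forall>B \<in> sets borel. marginal1 \<pi> B - marginal2 \<pi> B = \<mu> B)}"

definition wasserstein_space :: "((real ^ 'n) set \<Rightarrow> real ^ 'm) set" where
  "wasserstein_space = {\<mu>. vector_measure \<mu> \<and> \<mu> UNIV = 0 \<and>
     (\<exists>x0. (\<integral>\<^sup>+x. ennreal (norm (x - x0)) \<partial>total_variation \<mu>) < \<infinity>)}"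

definition transport_cost :: "(((real ^ 'n) \<times> (real ^ 'n)) set \<Rightarrow> real ^ 'm) \<Rightarrow> ennreal" where
  "transport_cost \<pi> = (\<integral>\<^sup>+(x, y). ennreal (norm (x - y)) \<partial>total_variation \<pi>)"

definition wasserstein_norm :: "((real ^ 'n) set \<Rightarrow> real ^ 'm) \<Rightarrow> ennreal" where
  "wasserstein_norm \<mu> = (INF \<pi> \<in> transports \<mu>. transport_cost \<pi>)"

definition optimal_transport ::
    "((real ^ 'n) set \<Rightarrow> real ^ 'm) \<Rightarrow> (((real ^ 'n) \<times> (real ^ 'n)) set \<Rightarrow> real ^ 'm) \<Rightarrow> bool" where
  "optimal_transport \<mu> \<pi> \<longleftrightarrow> \<pi> \<in> transports \<mu> \<and> wasserstein_norm \<mu> = transport_cost \<pi>"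

text \<open>
  The supremum is taken in \<open>ereal\<close>, where it does not depend on boundedness of the set of values.
\<close>

definition optimal_potential ::
    "((real ^ 'n) set \<Rightarrow> real ^ 'm) \<Rightarrow> (real ^ 'n \<Rightarrow> real ^ 'm) \<Rightarrow> bool" where
  "optimal_potential \<mu> u \<longleftrightarrow> 1-lipschitz_on UNIV u \<and>
     ereal (vector_integral \<mu> u) =
       (SUP v \<in> {v. 1-lipschitz_on UNIV v}. ereal (vector_integral \<mu> v))"

definition isometric_on :: "'a::real_normed_vector set \<Rightarrow> ('a \<Rightarrow> 'b::real_normed_vector) \<Rightarrow> bool" where
  "isometric_on S u \<longleftrightarrow> (\<forall>x\<in>S. \<forall>y\<in>S. norm (u x - u y) = norm (x - y))"

definition leaf :: "(real ^ 'n \<Rightarrow> real ^ 'm) \<Rightarrow> (real ^ 'n) set \<Rightarrow> bool" where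
  "leaf u S \<longleftrightarrow> isometric_on S u \<and> (\<forall>T. isometric_on T u \<longrightarrow> S \<subseteq> T \<longrightarrow> T = S)"

definition transport_set :: "(real ^ 'n \<Rightarrow> real ^ 'm) \<Rightarrow> (real ^ 'n) set \<Rightarrow> bool" where
  "transport_set u A \<longleftrightarrow> A \<in> sets borel \<and>
     (\<forall>x\<in>A. (\<exists>!S. leaf u S \<and> x \<in> S) \<longrightarrow>
        (\<forall>y. norm (u x - u y) = norm (x - y) \<longrightarrow> y \<in> A))"

definition vector_absolutely_continuous ::
    "'a::topological_space measure \<Rightarrow> ('a set \<Rightarrow> 'b::real_normed_vector) \<Rightarrow> bool" where
  "vector_absolutely_continuous M \<mu> \<longleftrightarrow> (\<forall>B \<in> null_sets M. \<mu> B = 0)"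

end

theory Submission
  imports Defs "HOL-Real_Asymp.Real_Asymp"
begin

text \<open>
  Suppose that an optimal potential \<open>u\<close> contracts every distance strictly. Then
  \<open>norm (u x - u y) = norm (x - y)\<close> only holds for \<open>x = y\<close>, the leaves of \<open>u\<close> are single points,
  and every Borel set is a transport set (\<open>transport_set_potential\<close>). So any nonzero measure with
  such a potential has a transport set of nonzero mass. If the infimum that defines the
  Wasserstein norm equals the dual supremum, then such a measure moreover has no optimal transport
  at all: the variation of an optimal \<open>\<pi>\<close> would be carried by the pairs on which \<open>u\<close> is isometric,
  which is the diagonal, so that it would transport for free (\<open>no_optimal_transport\<close>).

  Such a potential needs a target of dimension at least two. In a plane of the target, identified
  with the complex numbers, take \<open>u x = i * exp (i * t)\<close>, where \<open>t\<close> is a fixed coordinate of \<open>x\<close>.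
  A chord of the circle is strictly shorter than its arc, so \<open>u\<close> contracts strictly
  (\<open>potential_strict_contraction\<close>). The measure \<open>\<mu>\<close> has density \<open>exp (2 * i * t)\<close> on a slab where
  \<open>t\<close> runs through one full period of the density. The mass that has to cross level \<open>t\<close>, per unit
  of cross section, is the chord \<open>(exp (2 * i * t) - 1) / (2 * i) = sin t * exp (i * t)\<close>. It is
  antiparallel to the derivative of \<open>u\<close>, which is the condition for optimality, and the cost of
  pushing it upwards is the integral of \<open>sin t\<close> over the slab. The same number is the integral of
  \<open>u\<close> against \<open>\<mu>\<close>.

  The push is made of steps of length \<open>h = pi / k\<close>. Discretized in this way it is an exact
  transport of \<open>\<mu>\<close> (\<open>flow_balance\<close>), because the density adds up to zero over the vertices of a
  regular polygon, and its cost tends to the integral of \<open>sin t\<close> as \<open>h\<close> tends to zero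
  (\<open>wasserstein_norm_le_dual_value\<close>). Conversely weak duality (\<open>weak_duality_Lipschitz\<close>) bounds
  the integral of a \<open>1\<close>-Lipschitz map by the cost of any transport. It rests on the fact that a
  vector measure has a finite, countably additive variation (\<open>emeasure_total_variation\<close>,
  \<open>variation_finite\<close>).
\<close>

section \<open>The variation of a vector measure\<close>

text \<open>
  The set function that \<open>total_variation\<close> turns into a measure; the lemmas below show that it is
  countably additive, so that nothing is lost in that step.
\<close>

definition variation :: "('a::topological_space set \<Rightarrow> 'b::real_normed_vector) \<Rightarrow> 'a set \<Rightarrow> ennreal" where
  "variation \<mu> A = (SUP P \<in> {P. finite P \<and> disjoint P \<and> P \<subseteq> sets borel \<and> \<Union>P = A}.
     \<Sum>B\<in>P. ennreal (norm (\<mu> B)))"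

lemma variation_upper:
  assumes "finite P" "disjoint P" "P \<subseteq> sets borel"
  shows "(\<Sum>B\<in>P. ennreal (norm (\<mu> B))) \<le> variation \<mu> (\<Union>P)"
  unfolding variation_def using assms by (intro SUP_upper) auto

lemma norm_le_variation: "A \<in> sets borel \<Longrightarrow> ennreal (norm (\<mu> A)) \<le> variation \<mu> A"
  using variation_upper[of "{A}" \<mu>] by simp

lemma vector_measure_empty: "vector_measure \<mu> \<Longrightarrow> \<mu> {} = 0"
  by (simp add: vector_measure_def)

lemma vector_measure_sums:
  assumes "vector_measure \<mu>" "\<And>i. A i \<in> sets borel" "disjoint_family A"
  shows "(\<lambda>i::nat. \<mu> (A i)) sums \<mu> (\<Union>i. A i)"
  using assms by (auto simp: vector_measure_def image_subset_iff)

lemma vector_measure_Un: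
  assumes "vector_measure \<mu>" "A \<in> sets borel" "B \<in> sets borel" "A \<inter> B = {}"
  shows "\<mu> (A \<union> B) = \<mu> A + \<mu> B"
proof -
  have "(\<lambda>i. \<mu> (binaryset A B i)) sums \<mu> (\<Union>i. binaryset A B i)"
    by (rule vector_measure_sums) (use assms in \<open>auto simp: binaryset_def disjoint_family_on_def\<close>)
  moreover have "(\<lambda>i. \<mu> (binaryset A B i)) sums (\<mu> A + \<mu> B)"
    by (rule binaryset_sums) (simp add: vector_measure_empty assms)
  ultimately show ?thesis
    unfolding UN_binaryset_eq by (rule sums_unique2)
qed

lemma vector_measure_UN:
  assumes \<mu>: "vector_measure \<mu>" and "finite I" "\<And>i. i \<in> I \<Longrightarrow> A i \<in> sets borel" "disjoint_family_on A I"
  shows "\<mu> (\<Union>i\<in>I. A i) = (\<Sum>i\<in>I. \<mu> (A i))"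
  using assms(2-)
proof (induction I rule: finite_induct)
  case empty
  then show ?case by (simp add: vector_measure_empty[OF \<mu>])
next
  case (insert x I)
  have "\<mu> (A x \<union> (\<Union>i\<in>I. A i)) = \<mu> (A x) + \<mu> (\<Union>i\<in>I. A i)"
    by (rule vector_measure_Un[OF \<mu>])
       (use insert in \<open>auto simp: disjoint_family_on_def\<close>)
  with insert show ?case
    by (simp add: disjoint_family_on_def)
qed

text \<open>
  A partition of \<open>A\<close> and one of \<open>B\<close> together form a partition of \<open>A \<union> B\<close>. They can share only the
  empty set, which carries no mass, so their sums add up.
\<close>

lemma variation_superadditive:
  assumes \<mu>: "vector_measure \<mu>" and AB: "A \<in> sets borel" "B \<in> sets borel" "A \<inter> B = {}"
  shows "variation \<mu> A + variation \<mu> B \<le> variation \<mu> (A \<union> B)"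
proof -
  define PP where "PP A = {P :: 'a set set. finite P \<and> disjoint P \<and> P \<subseteq> sets borel \<and> \<Union>P = A}" for A
  define s where "s P = (\<Sum>B\<in>P. ennreal (norm (\<mu> B)))" for P
  have "{A} \<in> PP A" "{B} \<in> PP B"
    using AB by (auto simp: PP_def)
  then have ne: "PP A \<noteq> {}" "PP B \<noteq> {}"
    by blast+
  have v: "variation \<mu> C = (SUP P\<in>PP C. s P)" for C
    by (simp add: variation_def PP_def s_def)
  have le: "s P + s Q \<le> variation \<mu> (A \<union> B)" if P: "P \<in> PP A" and Q: "Q \<in> PP B" for P Q
  proof -
    have fin: "finite P" "finite Q" using P Q by (auto simp: PP_def)
    have "X \<subseteq> A" "X \<subseteq> B" if "X \<in> P \<inter> Q" for X
      using P Q that unfolding PP_def by blast+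
    then have "P \<inter> Q \<subseteq> {{}}"
      using AB(3) by blast
    then have "s (P \<inter> Q) = 0"
      unfolding s_def by (intro sum.neutral) (auto simp: vector_measure_empty[OF \<mu>])
    then have "s P + s Q = s (P \<union> Q)"
      unfolding s_def using sum.union_inter[OF fin, of "\<lambda>B. ennreal (norm (\<mu> B))"] by simp
    also have "\<dots> \<le> variation \<mu> (\<Union>(P \<union> Q))"
    proof -
      have "disjoint (P \<union> Q)"
        using P Q AB unfolding PP_def by (intro disjoint_union) auto
      then show ?thesis
        unfolding s_def using P Q by (intro variation_upper) (auto simp: PP_def)
    qed
    also have "\<Union>(P \<union> Q) = A \<union> B" using P Q by (auto simp: PP_def)
    finally show ?thesis .
  qed
  have "variation \<mu> A + variation \<mu> B = (SUP P\<in>PP A. s P + variation \<mu> B)"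
    unfolding v[of A] using ne by (simp add: ennreal_SUP_add_left)
  also have "\<dots> = (SUP P\<in>PP A. SUP Q\<in>PP B. s P + s Q)"
    unfolding v[of B] using ne by (simp add: ennreal_SUP_add_right)
  also have "\<dots> \<le> variation \<mu> (A \<union> B)"
    by (intro SUP_least le)
  finally show ?thesis .
qed

lemma variation_mono:
  assumes \<mu>: "vector_measure \<mu>" and AB: "A \<in> sets borel" "B \<in> sets borel" "A \<subseteq> B"
  shows "variation \<mu> A \<le> variation \<mu> B"
proof -
  have "variation \<mu> A \<le> variation \<mu> A + variation \<mu> (B - A)" by simp
  also have "\<dots> \<le> variation \<mu> (A \<union> (B - A))"
    by (rule variation_superadditive[OF \<mu>]) (use AB in auto)
  also have "A \<union> (B - A) = B" using AB by auto
  finally show ?thesis .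
qed

lemma ennreal_norm_sums_le:
  fixes f :: "nat \<Rightarrow> 'b::real_normed_vector"
  assumes "f sums s"
  shows "ennreal (norm s) \<le> (\<Sum>i. ennreal (norm (f i)))"
proof (rule LIMSEQ_le_const2)
  show "(\<lambda>n. ennreal (norm (\<Sum>i<n. f i))) \<longlonglongrightarrow> ennreal (norm s)"
    using assms by (intro tendsto_ennrealI tendsto_norm) (simp add: sums_def)
  have "ennreal (norm (\<Sum>i<n. f i)) \<le> (\<Sum>i. ennreal (norm (f i)))" for n
  proof -
    have "ennreal (norm (\<Sum>i<n. f i)) \<le> ennreal (\<Sum>i<n. norm (f i))"
      by (intro ennreal_leI norm_sum)
    also have "\<dots> = (\<Sum>i<n. ennreal (norm (f i)))" by simp
    also have "\<dots> \<le> (\<Sum>i. ennreal (norm (f i)))"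
      by (rule sum_le_suminf) auto
    finally show ?thesis .
  qed
  then show "\<exists>N. \<forall>n\<ge>N. ennreal (norm (\<Sum>i<n. f i)) \<le> (\<Sum>i. ennreal (norm (f i)))" by blast
qed

text \<open>
  Cutting each cell of a partition of the union along the sets \<open>A i\<close> does not decrease the sum, by
  the triangle inequality, and the pieces inside \<open>A i\<close> partition \<open>A i\<close>. Different cells may leave
  the same trace on \<open>A i\<close> only if it is empty.
\<close>

lemma variation_countably_subadditive:
  assumes \<mu>: "vector_measure \<mu>" and A: "\<And>i. A i \<in> sets borel" "disjoint_family A"
  shows "variation \<mu> (\<Union>i. A i) \<le> (\<Sum>i::nat. variation \<mu> (A i))"
  unfolding variation_def[of \<mu> "\<Union>i. A i"]
proof (rule SUP_least, unfold mem_Collect_eq, elim conjE)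
  fix P :: "'a set set"
  assume P: "finite P" "disjoint P" "P \<subseteq> sets borel" "\<Union>P = (\<Union>i. A i)"
  have "(\<Sum>B\<in>P. ennreal (norm (\<mu> B))) \<le> (\<Sum>B\<in>P. \<Sum>i. ennreal (norm (\<mu> (B \<inter> A i))))"
  proof (rule sum_mono)
    fix B assume B: "B \<in> P"
    have "(\<lambda>i. \<mu> (B \<inter> A i)) sums \<mu> (\<Union>i. B \<inter> A i)"
      by (rule vector_measure_sums[OF \<mu>])
         (use A P B in \<open>auto simp: disjoint_family_on_def\<close>)
    also have "(\<Union>i. B \<inter> A i) = B" using P(4) B by auto
    finally show "ennreal (norm (\<mu> B)) \<le> (\<Sum>i. ennreal (norm (\<mu> (B \<inter> A i))))"
      by (rule ennreal_norm_sums_le)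
  qed
  also have "\<dots> = (\<Sum>i. \<Sum>B\<in>P. ennreal (norm (\<mu> (B \<inter> A i))))"
    by (rule suminf_sum[symmetric]) auto
  also have "\<dots> \<le> (\<Sum>i. variation \<mu> (A i))"
  proof (rule suminf_le)
    fix i
    have *: "\<mu> (B \<inter> A i) = 0" if "B \<in> P" "C \<in> P" "B \<noteq> C" "B \<inter> A i = C \<inter> A i" for B C
    proof -
      have "B \<inter> C = {}" using P(2) that by (auto simp: pairwise_def disjnt_def)
      then have "B \<inter> A i = {}" using that by auto
      then show ?thesis by (simp add: vector_measure_empty[OF \<mu>])
    qed
    have "(\<Sum>B\<in>P. ennreal (norm (\<mu> (B \<inter> A i)))) = (\<Sum>C\<in>(\<lambda>B. B \<inter> A i) ` P. ennreal (norm (\<mu> C)))"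
      by (subst sum.reindex_nontrivial) (use P * in \<open>auto simp: o_def\<close>)
    also have "\<dots> \<le> variation \<mu> (\<Union>((\<lambda>B. B \<inter> A i) ` P))"
      by (rule variation_upper) (use P A in \<open>auto simp: pairwise_def disjnt_def; blast\<close>)+
    also have "\<Union>((\<lambda>B. B \<inter> A i) ` P) = A i" using P(4) by auto
    finally show "(\<Sum>B\<in>P. ennreal (norm (\<mu> (B \<inter> A i)))) \<le> variation \<mu> (A i)" .
  qed auto
  finally show "(\<Sum>B\<in>P. ennreal (norm (\<mu> B))) \<le> (\<Sum>i. variation \<mu> (A i))" .
qed

lemma variation_countably_superadditive:
  assumes \<mu>: "vector_measure \<mu>" and A: "\<And>i. A i \<in> sets borel" "disjoint_family A"
  shows "(\<Sum>i::nat. variation \<mu> (A i)) \<le> variation \<mu> (\<Union>i. A i)"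
proof -
  have fin: "(\<Sum>i<n. variation \<mu> (A i)) \<le> variation \<mu> (\<Union>i<n. A i)" for n
  proof (induction n)
    case (Suc n)
    have "(\<Sum>i<Suc n. variation \<mu> (A i)) \<le> variation \<mu> (\<Union>i<n. A i) + variation \<mu> (A n)"
      using Suc by (simp add: add_right_mono)
    also have "\<dots> \<le> variation \<mu> ((\<Union>i<n. A i) \<union> A n)"
      by (rule variation_superadditive[OF \<mu>])
         (use A in \<open>auto simp: disjoint_family_on_def\<close>, metis IntI empty_iff nat_neq_iff)
    finally show ?case by (simp add: lessThan_Suc Un_commute)
  qed simp
  have "(\<Sum>i<n. variation \<mu> (A i)) \<le> variation \<mu> (\<Union>i. A i)" for n
    by (rule order.trans[OF fin variation_mono[OF \<mu>]]) (use A in auto)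
  then show ?thesis
    by (intro suminf_le_const) auto
qed

lemma sets_total_variation [simp, measurable_cong]: "sets (total_variation \<mu>) = sets borel"
  and space_total_variation [simp]: "space (total_variation \<mu>) = UNIV"
  unfolding total_variation_def
  using sets.sets_measure_of_eq[of borel] sets.space_measure_of_eq[of borel] by auto

lemma emeasure_total_variation:
  assumes \<mu>: "vector_measure \<mu>" and A: "A \<in> sets borel"
  shows "emeasure (total_variation \<mu>) A = variation \<mu> A"
proof -
  have "emeasure (measure_of UNIV (sets borel) (variation \<mu>)) A = variation \<mu> A"
  proof (rule emeasure_measure_of_sigma)
    show "sigma_algebra UNIV (sets (borel :: 'a measure))"
      using sets.sigma_algebra_axioms[of "borel :: 'a measure"] by simp
    have "variation \<mu> {} = 0"
      unfolding variation_def
      by (rule antisym[OF SUP_least])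
         (auto simp: vector_measure_empty[OF \<mu>] simp del: sum_ennreal intro!: sum.neutral)
    then show "positive (sets borel) (variation \<mu>)" by (simp add: positive_def)
    show "countably_additive (sets borel) (variation \<mu>)"
      unfolding countably_additive_def
      using variation_countably_subadditive[OF \<mu>] variation_countably_superadditive[OF \<mu>]
      by (auto intro!: antisym simp: image_subset_iff)
  qed (use A in simp)
  then show ?thesis
    unfolding total_variation_def variation_def .
qed

text \<open>
  In each coordinate the cells of positive mass and the cells of negative mass have unions whose
  masses are bounded by \<open>t\<close>; this bounds the sum of absolute values by \<open>2 * t\<close> per coordinate.
\<close>

lemma variation_le_of_bounded:
  fixes \<mu> :: "'a::topological_space set \<Rightarrow> 'b::euclidean_space" and t :: real
  assumes \<mu>: "vector_measure \<mu>" and t: "\<And>A. A \<in> sets borel \<Longrightarrow> A \<subseteq> E \<Longrightarrow> norm (\<mu> A) \<le> t"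
  shows "variation \<mu> E \<le> ennreal (DIM('b) * (2 * t))"
  unfolding variation_def
proof (rule SUP_least, unfold mem_Collect_eq, elim conjE)
  fix P :: "'a set set"
  assume P: "finite P" "disjoint P" "P \<subseteq> sets borel" and E: "\<Union>P = E"
  have coord: "(\<Sum>B\<in>P. \<bar>\<mu> B \<bullet> b\<bar>) \<le> 2 * t" if b: "b \<in> Basis" for b
  proof -
    have part: "\<bar>\<Sum>B\<in>Q. \<mu> B \<bullet> b\<bar> \<le> t" if Q: "Q \<subseteq> P" for Q
    proof -
      have finQ: "finite Q" using P(1) Q by (rule finite_subset[rotated])
      have "(\<Sum>B\<in>Q. \<mu> B) = \<mu> (\<Union>B\<in>Q. B)"
        by (rule vector_measure_UN[OF \<mu> finQ, symmetric])
           (use P Q in \<open>auto simp: disjoint_family_on_def pairwise_def disjnt_def\<close>)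
      moreover have "norm (\<mu> (\<Union>B\<in>Q. B)) \<le> t"
        by (rule t) (use P Q finQ E in auto)
      moreover have "\<bar>(\<Sum>B\<in>Q. \<mu> B) \<bullet> b\<bar> \<le> norm (\<Sum>B\<in>Q. \<mu> B)"
        using b by (rule Basis_le_norm)
      ultimately show ?thesis unfolding inner_sum_left[symmetric] by simp
    qed
    have "(\<Sum>B\<in>P. \<bar>\<mu> B \<bullet> b\<bar>) = (\<Sum>B\<in>{B\<in>P. \<mu> B \<bullet> b \<ge> 0}. \<bar>\<mu> B \<bullet> b\<bar>) + (\<Sum>B\<in>{B\<in>P. \<not> \<mu> B \<bullet> b \<ge> 0}. \<bar>\<mu> B \<bullet> b\<bar>)"
      using P(1) by (subst sum.union_disjoint[symmetric]) (auto intro!: sum.cong)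
    also have "\<dots> = (\<Sum>B\<in>{B\<in>P. \<mu> B \<bullet> b \<ge> 0}. \<mu> B \<bullet> b) - (\<Sum>B\<in>{B\<in>P. \<not> \<mu> B \<bullet> b \<ge> 0}. \<mu> B \<bullet> b)"
      by (simp add: sum_negf[symmetric] del: sum_negf)
    also have "\<dots> \<le> 2 * t"
      using part[of "{B\<in>P. \<mu> B \<bullet> b \<ge> 0}"] part[of "{B\<in>P. \<not> \<mu> B \<bullet> b \<ge> 0}"] by auto
    finally show ?thesis .
  qed
  have "(\<Sum>B\<in>P. norm (\<mu> B)) \<le> (\<Sum>B\<in>P. \<Sum>b\<in>Basis. \<bar>\<mu> B \<bullet> b\<bar>)"
    by (intro sum_mono norm_le_l1)
  also have "\<dots> = (\<Sum>b\<in>Basis. \<Sum>B\<in>P. \<bar>\<mu> B \<bullet> b\<bar>)" by (rule sum.swap)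
  also have "\<dots> \<le> (\<Sum>b\<in>(Basis::'b set). 2 * t)" by (intro sum_mono coord)
  also have "\<dots> = DIM('b) * (2 * t)" by simp
  finally show "(\<Sum>B\<in>P. ennreal (norm (\<mu> B))) \<le> ennreal (DIM('b) * (2 * t))"
    by (simp add: ennreal_leI)
qed

text \<open>
  If a set has infinite variation, it contains a subset \<open>A\<close> of mass larger than the mass of the
  whole set plus one, so \<open>A\<close> and its complement both have mass at least one, and one of them still
  has infinite variation. Splitting off the other one again and again gives disjoint sets of mass
  at least one, which contradicts the convergence of the sum of their masses.
\<close>

lemma variation_finite:
  fixes \<mu> :: "'a::topological_space set \<Rightarrow> 'b::euclidean_space"
  assumes \<mu>: "vector_measure \<mu>"
  shows "variation \<mu> UNIV < \<infinity>"
proof (rule ccontr)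
  assume inf: "\<not> ?thesis"
  have split: "\<exists>A. A \<in> sets borel \<and> A \<subseteq> E \<and> 1 \<le> norm (\<mu> A) \<and> variation \<mu> (E - A) = \<infinity>"
    if E: "E \<in> sets borel" "variation \<mu> E = \<infinity>" for E
  proof -
    obtain A where A: "A \<in> sets borel" "A \<subseteq> E" "1 + norm (\<mu> E) < norm (\<mu> A)"
    proof (rule ccontr)
      assume "\<not> thesis"
      then have "\<And>A. A \<in> sets borel \<Longrightarrow> A \<subseteq> E \<Longrightarrow> norm (\<mu> A) \<le> 1 + norm (\<mu> E)"
        using that by force
      then have "variation \<mu> E \<le> ennreal (DIM('b) * (2 * (1 + norm (\<mu> E))))"
        by (intro variation_le_of_bounded[OF \<mu>])
      with E(2) show False by (simp add: top_unique)
    qed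
    \<comment> \<open>the margin in the choice of \<open>A\<close> makes both parts of \<open>E\<close> heavy, whichever of them is kept\<close>
    have "\<mu> E = \<mu> (A \<union> (E - A))" using A by (simp add: Un_absorb1)
    also have "\<dots> = \<mu> A + \<mu> (E - A)"
      by (rule vector_measure_Un[OF \<mu>]) (use A E in auto)
    finally have "\<mu> (E - A) = \<mu> E - \<mu> A" by simp
    then have "norm (\<mu> A) - norm (\<mu> E) \<le> norm (\<mu> (E - A))"
      using norm_triangle_ineq2[of "\<mu> A" "\<mu> E"] by (simp add: norm_minus_commute)
    then have big: "1 \<le> norm (\<mu> A)" "1 \<le> norm (\<mu> (E - A))"
      using A(3) norm_ge_zero[of "\<mu> E"] by linarith+
    have "emeasure (total_variation \<mu>) E = emeasure (total_variation \<mu>) A + emeasure (total_variation \<mu>) (E - A)"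
      by (subst plus_emeasure) (use A E in \<open>auto simp: Un_absorb1\<close>)
    then have "variation \<mu> A + variation \<mu> (E - A) = \<infinity>"
      using A E by (simp add: emeasure_total_variation[OF \<mu>])
    then have "variation \<mu> A = \<infinity> \<or> variation \<mu> (E - A) = \<infinity>"
      by simp
    moreover have "E - (E - A) = A" using A by auto
    ultimately show ?thesis
      using A(1,2) E(1) big by (metis Diff_subset sets.Diff)
  qed
  define f where
    "f E = (SOME A. A \<in> sets borel \<and> A \<subseteq> E \<and> 1 \<le> norm (\<mu> A) \<and> variation \<mu> (E - A) = \<infinity>)" for E
  have f: "f E \<in> sets borel" "f E \<subseteq> E" "1 \<le> norm (\<mu> (f E))" "variation \<mu> (E - f E) = \<infinity>"
    if "E \<in> sets borel" "variation \<mu> E = \<infinity>" for E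
    using someI_ex[OF split[OF that]] unfolding f_def by blast+
  \<comment> \<open>what remains of the whole space after \<open>n\<close> splittings\<close>
  define R where "R n = ((\<lambda>E. E - f E) ^^ n) UNIV" for n
  have R_Suc: "R (Suc n) = R n - f (R n)" for n by (simp add: R_def)
  have R: "R n \<in> sets borel \<and> variation \<mu> (R n) = \<infinity>" for n
  proof (induction n)
    case 0
    show ?case using inf by (simp add: R_def not_less top_unique)
  next
    case (Suc n)
    then show ?case using f[of "R n"] by (auto simp: R_Suc)
  qed
  have dec: "decseq R" by (rule decseq_SucI) (auto simp: R_Suc)
  have "disjoint_family (\<lambda>n. f (R n))"
  proof -
    have "f (R m) \<inter> f (R n) = {}" if "m < n" for m n
    proof -
      have "f (R n) \<subseteq> R (Suc m)" using f(2)[of "R n"] R[of n] decseqD[OF dec, of "Suc m" n] that by auto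
      then show ?thesis by (auto simp: R_Suc)
    qed
    then show ?thesis
      unfolding disjoint_family_on_def by (metis Int_commute nat_neq_iff)
  qed
  with f(1) R have "(\<lambda>n. \<mu> (f (R n))) sums \<mu> (\<Union>n. f (R n))"
    by (intro vector_measure_sums[OF \<mu>]) auto
  then have "(\<lambda>n. \<mu> (f (R n))) \<longlonglongrightarrow> 0"
    by (intro summable_LIMSEQ_zero) (rule sums_summable)
  then have "(\<lambda>n. norm (\<mu> (f (R n)))) \<longlonglongrightarrow> 0" by (rule tendsto_norm_zero)
  then have "1 \<le> (0::real)"
    by (rule LIMSEQ_le_const) (use f(3) R in blast)
  then show False by simp
qed

lemma finite_measure_total_variation:
  fixes \<mu> :: "'a::topological_space set \<Rightarrow> 'b::euclidean_space"
  assumes \<mu>: "vector_measure \<mu>"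
  shows "finite_measure (total_variation \<mu>)"
  by (rule finite_measureI) (use variation_finite[OF \<mu>] in \<open>simp add: emeasure_total_variation[OF \<mu>] less_top\<close>)

section \<open>Vector measures with a density\<close>

text \<open>
  The image under \<open>T\<close> of the vector measure that has density \<open>f\<close> with respect to \<open>M\<close>. For the
  Lebesgue measure and the identity this gives absolutely continuous measures; with
  \<open>T x = (x, x + p)\<close> it gives transports along a fixed direction.
\<close>

definition pushforward ::
    "'x measure \<Rightarrow> ('x \<Rightarrow> 'a) \<Rightarrow> ('x \<Rightarrow> 'b::{banach, second_countable_topology}) \<Rightarrow> 'a set \<Rightarrow> 'b" where
  "pushforward M T f B = (\<integral>x. indicator B (T x) *\<^sub>R f x \<partial>M)"

lemma integrable_pushforward:
  fixes f :: "'x \<Rightarrow> 'b::{banach, second_countable_topology}"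
  assumes T: "T \<in> measurable M borel" and f: "integrable M f" and B: "B \<in> sets borel"
  shows "integrable M (\<lambda>x. indicator B (T x) *\<^sub>R f x)"
proof -
  have "integrable M (\<lambda>x. indicator (T -` B \<inter> space M) x *\<^sub>R f x)"
    using measurable_sets[OF T B] f by (rule integrable_mult_indicator)
  then show ?thesis
    by (rule Bochner_Integration.integrable_cong[THEN iffD1, rotated -1]) (auto simp: indicator_def)
qed

lemma vector_measure_pushforward:
  fixes f :: "'x \<Rightarrow> 'b::{banach, second_countable_topology}"
  assumes T: "T \<in> measurable M borel" and f: "integrable M f"
  shows "vector_measure (pushforward M T f)"
  unfolding vector_measure_def
proof (intro conjI allI impI)
  show "pushforward M T f {} = 0" by (simp add: pushforward_def)
  fix A :: "nat \<Rightarrow> 'a set"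
  assume A: "range A \<subseteq> sets borel" and dis: "disjoint_family A"
  have [measurable]: "A i \<in> sets borel" for i using A by auto
  note T [measurable]
  have [measurable]: "f \<in> borel_measurable M" using f by simp
  have "(\<lambda>n. \<integral>x. indicator (\<Union>i<n. A i) (T x) *\<^sub>R f x \<partial>M) \<longlonglongrightarrow> pushforward M T f (\<Union>i. A i)"
    unfolding pushforward_def
  proof (rule integral_dominated_convergence[where w = "\<lambda>x. norm (f x)"])
    show "AE x in M. (\<lambda>n. indicat_real (\<Union>i<n. A i) (T x) *\<^sub>R f x)
        \<longlonglongrightarrow> indicator (\<Union>i. A i) (T x) *\<^sub>R f x"
      by (intro AE_I2 tendsto_scaleR LIMSEQ_indicator_UN tendsto_const)
  qed (use f in \<open>auto simp: indicator_def\<close>)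
  moreover have "(\<integral>x. indicator (\<Union>i<n. A i) (T x) *\<^sub>R f x \<partial>M) = (\<Sum>i<n. pushforward M T f (A i))" for n
  proof -
    have "(\<integral>x. indicator (\<Union>i<n. A i) (T x) *\<^sub>R f x \<partial>M)
        = (\<integral>x. (\<Sum>i<n. indicator (A i) (T x) *\<^sub>R f x) \<partial>M)"
      using dis by (subst indicator_UN_disjoint)
        (auto simp: scaleR_sum_left intro: disjoint_family_on_mono)
    also have "\<dots> = (\<Sum>i<n. pushforward M T f (A i))"
      unfolding pushforward_def
      by (intro Bochner_Integration.integral_sum integrable_pushforward[OF T f]) auto
    finally show ?thesis .
  qed
  ultimately show "(\<lambda>i. pushforward M T f (A i)) sums pushforward M T f (\<Union>i. A i)"
    by (simp add: sums_def)
qed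

lemma variation_pushforward_le:
  fixes f :: "'x \<Rightarrow> 'b::{banach, second_countable_topology}"
  assumes T [measurable]: "T \<in> measurable M borel" and f: "integrable M f"
  shows "variation (pushforward M T f) A \<le> (\<integral>\<^sup>+x. ennreal (norm (f x)) * indicator A (T x) \<partial>M)"
  unfolding variation_def
proof (rule SUP_least, unfold mem_Collect_eq, elim conjE)
  fix P :: "'a set set"
  assume P: "finite P" "disjoint P" "P \<subseteq> sets borel" "\<Union>P = A"
  have [measurable]: "f \<in> borel_measurable M" using f by simp
  have [measurable]: "B \<in> sets borel" if "B \<in> P" for B using P that by auto
  have "ennreal (norm (pushforward M T f B)) \<le> (\<integral>\<^sup>+x. ennreal (norm (f x)) * indicator B (T x) \<partial>M)" if "B \<in> P" for B
  proof -
    have "ennreal (norm (pushforward M T f B)) \<le> (\<integral>\<^sup>+x. norm (indicat_real B (T x) *\<^sub>R f x) \<partial>M)"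
      unfolding pushforward_def using P(3) that
      by (intro integral_norm_bound_ennreal integrable_pushforward[OF T f]) auto
    also have "\<dots> = (\<integral>\<^sup>+x. ennreal (norm (f x)) * indicator B (T x) \<partial>M)"
      by (intro nn_integral_cong) (auto simp: indicator_def)
    finally show ?thesis .
  qed
  then have "(\<Sum>B\<in>P. ennreal (norm (pushforward M T f B)))
      \<le> (\<Sum>B\<in>P. \<integral>\<^sup>+x. ennreal (norm (f x)) * indicator B (T x) \<partial>M)"
    by (rule sum_mono)
  also have "\<dots> = (\<integral>\<^sup>+x. (\<Sum>B\<in>P. ennreal (norm (f x)) * indicator B (T x)) \<partial>M)"
    by (rule nn_integral_sum[symmetric]) measurable
  also have "\<dots> = (\<integral>\<^sup>+x. ennreal (norm (f x)) * indicator A (T x) \<partial>M)"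
  proof (rule nn_integral_cong)
    fix x
    have "indicator A (T x) = (\<Sum>B\<in>P. indicator B (T x) :: ennreal)"
      using P by (subst indicator_UN_disjoint[symmetric])
        (auto simp: disjoint_family_on_def pairwise_def disjnt_def)
    then show "(\<Sum>B\<in>P. ennreal (norm (f x)) * indicator B (T x)) = ennreal (norm (f x)) * indicator A (T x)"
      by (simp add: sum_distrib_left)
  qed
  finally show "(\<Sum>B\<in>P. ennreal (norm (pushforward M T f B)))
      \<le> (\<integral>\<^sup>+x. ennreal (norm (f x)) * indicator A (T x) \<partial>M)" .
qed

text \<open>
  Equality fails in general, as masses that \<open>T\<close> brings together may cancel, but upper bounds on
  costs and moments need only this direction.
\<close>

lemma nn_integral_total_variation_pushforward_le:
  fixes f :: "'x \<Rightarrow> 'b::{banach, second_countable_topology}"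
  assumes T [measurable]: "T \<in> measurable M borel" and f: "integrable M f"
    and \<phi> [measurable]: "\<phi> \<in> borel_measurable borel"
  shows "(\<integral>\<^sup>+y. \<phi> y \<partial>total_variation (pushforward M T f)) \<le> (\<integral>\<^sup>+x. ennreal (norm (f x)) * \<phi> (T x) \<partial>M)"
proof -
  have [measurable]: "f \<in> borel_measurable M" using f by simp
  define N where "N = distr (density M (\<lambda>x. ennreal (norm (f x)))) borel T"
  have N: "emeasure N A = (\<integral>\<^sup>+x. ennreal (norm (f x)) * indicator A (T x) \<partial>M)"
    if [measurable]: "A \<in> sets borel" for A
    unfolding N_def
    by (subst emeasure_distr, simp, simp, subst emeasure_density)
       (auto intro!: nn_integral_cong simp: indicator_def)
  have "emeasure (total_variation (pushforward M T f)) A \<le> emeasure N A" for A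
  proof (cases "A \<in> sets borel")
    case True
    then show ?thesis
      using variation_pushforward_le[OF T f, of A]
      by (simp add: emeasure_total_variation[OF vector_measure_pushforward[OF T f]] N)
  qed (simp add: emeasure_notin_sets)
  moreover have "space N = UNIV" "sets N = sets borel" by (simp_all add: N_def)
  ultimately have "total_variation (pushforward M T f) \<le> N"
    by (simp add: le_measure_iff le_fun_def)
  then have "(\<integral>\<^sup>+y. \<phi> y \<partial>total_variation (pushforward M T f)) \<le> (\<integral>\<^sup>+y. \<phi> y \<partial>N)"
    by (intro nn_integral_mono_measure) (simp_all add: N_def)
  also have "\<dots> = (\<integral>\<^sup>+x. ennreal (norm (f x)) * \<phi> (T x) \<partial>M)"
    unfolding N_def by (simp add: nn_integral_distr nn_integral_density)
  finally show ?thesis .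
qed

text \<open>
  The supremum is attained at the part of \<open>A\<close> on which \<open>f\<close> is nonnegative. The coercion \<open>ennreal\<close>
  cuts off the negative part of the density on the right.
\<close>

lemma positive_variation_density:
  fixes f :: "'a::topological_space \<Rightarrow> real"
  assumes M: "sets M = sets borel" and f: "integrable M f"
  shows "positive_variation (\<lambda>B. \<integral>x. indicator B x * f x \<partial>M) = density M (\<lambda>x. ennreal (f x))"
proof -
  have sp: "space M = UNIV" using sets_eq_imp_space_eq[OF M] by simp
  have f' [measurable]: "f \<in> borel_measurable M" using f by simp
  have int: "integrable M (\<lambda>x. indicator B x * h x)" if "B \<in> sets M" "integrable M h" for B and h :: "'a \<Rightarrow> real"
    using integrable_mult_indicator[OF that] by simp
  have max: "integrable M (\<lambda>x. max 0 (f x))" using f by auto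
  have eq: "(SUP B \<in> {B \<in> sets borel. B \<subseteq> A}. ennreal (\<integral>x. indicator B x * f x \<partial>M))
      = emeasure (density M (\<lambda>x. ennreal (f x))) A" (is "?S = ?E") if A: "A \<in> sets borel" for A
  proof -
    have A' [measurable]: "A \<in> sets M" using A M by simp
    have E: "?E = ennreal (\<integral>x. indicator A x * max 0 (f x) \<partial>M)"
    proof -
      have "?E = (\<integral>\<^sup>+x. ennreal (indicator A x * max 0 (f x)) \<partial>M)"
        by (subst emeasure_density) (auto intro!: nn_integral_cong simp: indicator_def max_def ennreal_neg)
      then show ?thesis
        by (simp add: nn_integral_eq_integral[OF int[OF A' max]])
    qed
    show ?thesis
    proof (rule antisym)
      show "?S \<le> ?E"
        unfolding E
        by (intro SUP_least ennreal_leI integral_mono int f max)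
           (use A M in \<open>auto simp: indicator_def\<close>)
      define B where "B = {x \<in> A. f x \<ge> 0}"
      have "B = A \<inter> {x \<in> space M. f x \<ge> 0}" by (auto simp: B_def sp)
      then have "B \<in> sets M" by simp
      then have "B \<in> sets borel" "B \<subseteq> A" using M by (auto simp: B_def)
      moreover have "?E = ennreal (\<integral>x. indicator B x * f x \<partial>M)"
        unfolding E by (intro arg_cong[of _ _ ennreal] Bochner_Integration.integral_cong)
          (auto simp: B_def indicator_def)
      ultimately show "?E \<le> ?S" by (auto intro: SUP_upper2)
    qed
  qed
  have "positive_variation (\<lambda>B. \<integral>x. indicator B x * f x \<partial>M)
      = measure_of UNIV (sets borel) (emeasure (density M (\<lambda>x. ennreal (f x))))"
    unfolding positive_variation_def
    using sets.sigma_sets_eq[of "borel :: 'a measure"]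
    by (intro measure_of_eq) (auto simp: eq)
  also have "\<dots> = density M (\<lambda>x. ennreal (f x))"
    using measure_of_of_measure[of "density M (\<lambda>x. ennreal (f x))"] by (simp add: M sp)
  finally show ?thesis .
qed

lemma signed_integral_density:
  fixes f \<phi> :: "'a::topological_space \<Rightarrow> real"
  assumes M: "sets M = sets borel" and f: "integrable M f"
    and \<phi>: "\<phi> \<in> borel_measurable M" and \<phi>f: "integrable M (\<lambda>x. \<phi> x * f x)"
  shows "signed_integral (\<lambda>B. \<integral>x. indicator B x * f x \<partial>M) \<phi> = (\<integral>x. \<phi> x * f x \<partial>M)"
proof -
  have [measurable]: "f \<in> borel_measurable M" "\<phi> \<in> borel_measurable M" using f \<phi> by auto
  have dens: "integral\<^sup>L (density M (\<lambda>x. ennreal (h x))) \<phi> = (\<integral>x. max 0 (h x) * \<phi> x \<partial>M)"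
    if [measurable]: "h \<in> borel_measurable M" for h
  proof -
    have "(\<lambda>x. ennreal (h x)) = (\<lambda>x. ennreal (max 0 (h x)))"
      by (auto simp: max_def ennreal_neg)
    then show ?thesis by (simp add: integral_density)
  qed
  have int: "integrable M (\<lambda>x. max 0 (h x) * \<phi> x)"
    if [measurable]: "h \<in> borel_measurable M" and "\<And>x. \<bar>h x\<bar> = \<bar>f x\<bar>" for h
  proof (rule Bochner_Integration.integrable_bound[OF \<phi>f])
    have "norm (max 0 (h x) * \<phi> x) \<le> norm (\<phi> x * f x)" for x
    proof -
      have "\<bar>max 0 (h x)\<bar> \<le> \<bar>f x\<bar>" using that(2)[of x] by auto
      then have "\<bar>max 0 (h x)\<bar> * \<bar>\<phi> x\<bar> \<le> \<bar>f x\<bar> * \<bar>\<phi> x\<bar>" by (rule mult_right_mono) simp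
      then show ?thesis by (simp add: abs_mult mult.commute)
    qed
    then show "AE x in M. norm (max 0 (h x) * \<phi> x) \<le> norm (\<phi> x * f x)" by simp
  qed measurable
  have neg: "(\<lambda>B. - (\<integral>x. indicator B x * f x \<partial>M)) = (\<lambda>B. \<integral>x. indicator B x * (- f x) \<partial>M)"
    by simp
  have "signed_integral (\<lambda>B. \<integral>x. indicator B x * f x \<partial>M) \<phi>
      = (\<integral>x. max 0 (f x) * \<phi> x \<partial>M) - (\<integral>x. max 0 (- f x) * \<phi> x \<partial>M)"
    unfolding signed_integral_def neg
    using f by (simp only: positive_variation_density[OF M] integrable_minus dens) (simp add: dens)
  also have "\<dots> = (\<integral>x. max 0 (f x) * \<phi> x - max 0 (- f x) * \<phi> x \<partial>M)"
    by (intro Bochner_Integration.integral_diff[symmetric] int) auto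
  also have "\<dots> = (\<integral>x. \<phi> x * f x \<partial>M)"
    by (intro Bochner_Integration.integral_cong) (auto simp: max_def)
  finally show ?thesis .
qed

lemma vector_integral_pushforward:
  fixes f v :: "'a::topological_space \<Rightarrow> real ^ 'm::finite"
  assumes M: "sets M = sets borel" and f: "integrable M f"
    and v: "v \<in> borel_measurable M" and vf: "integrable M (\<lambda>x. norm (v x) * norm (f x))"
  shows "vector_integral (pushforward M (\<lambda>x. x) f) v = (\<integral>x. v x \<bullet> f x \<partial>M)"
proof -
  have [measurable]: "v \<in> borel_measurable M" "f \<in> borel_measurable M" using f v by auto
  have id: "(\<lambda>x. x) \<in> measurable M borel" by (simp add: measurable_def M sets_eq_imp_space_eq[OF M])
  have nth: "bounded_linear (\<lambda>y :: real ^ 'm. y $ i)" for i by (rule bounded_linear_vec_nth)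
  have fi: "integrable M (\<lambda>x. f x $ i)" for i
    using f by (rule integrable_bounded_linear[OF nth])
  have mi: "(\<lambda>x. v x $ i) \<in> borel_measurable M" "(\<lambda>x. f x $ i) \<in> borel_measurable M" for i
    by (auto intro!: borel_measurable_continuous_on[where f = "\<lambda>y. y $ i"] continuous_intros)
  have vfi: "integrable M (\<lambda>x. v x $ i * f x $ i)" for i
  proof (rule Bochner_Integration.integrable_bound[OF vf])
    show "AE x in M. norm (v x $ i * f x $ i) \<le> norm (norm (v x) * norm (f x))"
      by (auto simp: abs_mult intro!: mult_mono component_le_norm_cart)
  qed (use mi in measurable)
  have "signed_integral (\<lambda>B. pushforward M (\<lambda>x. x) f B $ i) (\<lambda>x. v x $ i) = (\<integral>x. v x $ i * f x $ i \<partial>M)" for i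
  proof -
    have *: "pushforward M (\<lambda>x. x) f B $ i = (\<integral>x. indicator B x * f x $ i \<partial>M)" if "B \<in> sets borel" for B
      unfolding pushforward_def
      by (subst integral_bounded_linear[OF nth, symmetric, OF integrable_pushforward[OF id f that]]) simp
    have pv: "positive_variation (\<lambda>B. c * pushforward M (\<lambda>x. x) f B $ i)
        = positive_variation (\<lambda>B. c * (\<integral>x. indicator B x * f x $ i \<partial>M))" for c
      unfolding positive_variation_def
      using sets.sigma_sets_eq[of "borel :: 'a measure"]
      by (intro measure_of_eq SUP_cong) (auto simp: *)
    have "signed_integral (\<lambda>B. pushforward M (\<lambda>x. x) f B $ i) (\<lambda>x. v x $ i)
        = signed_integral (\<lambda>B. \<integral>x. indicator B x * f x $ i \<partial>M) (\<lambda>x. v x $ i)"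
      using pv[of 1] pv[of "-1"] by (simp add: signed_integral_def)
    then show ?thesis using signed_integral_density[OF M fi mi(1) vfi] by simp
  qed
  then have "vector_integral (pushforward M (\<lambda>x. x) f) v = (\<Sum>i\<in>UNIV. \<integral>x. v x $ i * f x $ i \<partial>M)"
    by (simp add: vector_integral_def)
  also have "\<dots> = (\<integral>x. v x \<bullet> f x \<partial>M)"
    unfolding inner_vec_def inner_real_def
    by (rule Bochner_Integration.integral_sum[symmetric]) (rule vfi)
  finally show ?thesis .
qed

section \<open>Weak duality\<close>

lemma borel_measurable_fst_borel [measurable]:
  "(fst :: 'a::topological_space \<times> 'b::topological_space \<Rightarrow> 'a) \<in> borel_measurable borel"
  and borel_measurable_snd_borel [measurable]:
  "(snd :: 'a::topological_space \<times> 'b::topological_space \<Rightarrow> 'b) \<in> borel_measurable borel"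
  by (intro borel_measurable_continuous_onI continuous_intros)+

text \<open>
  A function with finitely many values turns both integrals into sums over the rectangles of its
  level sets. Writing \<open>\<mu>\<close> as the difference of the marginals of \<open>\<pi>\<close> and exchanging the two indices
  in the second marginal, the left side becomes the sum of \<open>(c - d) \<bullet> \<pi> (s -` {c} \<times> s -` {d})\<close>.
  This way of arguing avoids integration against \<open>\<pi>\<close> itself.
\<close>

lemma weak_duality_simple:
  fixes \<pi> :: "((real ^ 'n::finite) \<times> (real ^ 'n)) set \<Rightarrow> real ^ 'm::finite"
  assumes \<pi>: "\<pi> \<in> transports \<mu>" and s [measurable]: "s \<in> borel_measurable borel" and fin: "finite (range s)"
  shows "(\<Sum>c\<in>range s. c \<bullet> \<mu> (s -` {c})) \<le> (\<integral>z. norm (s (fst z) - s (snd z)) \<partial>total_variation \<pi>)"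
proof -
  have vm: "vector_measure \<pi>" using \<pi> by (simp add: transports_def)
  interpret finite_measure "total_variation \<pi>" by (rule finite_measure_total_variation[OF vm])
  define B where "B c = s -` {c}" for c
  define S where "S = range s"
  have [measurable]: "B c \<in> sets borel" for c
    using measurable_sets[OF s, of "{c}"] by (simp add: B_def)
  have rect [measurable]: "B c \<times> B d \<in> sets borel" for c d by (intro borel_Times) measurable
  have finS: "finite S" using fin by (simp add: S_def)
  have UB: "(\<Union>d\<in>S. B d) = UNIV" by (auto simp: B_def S_def)
  have row: "\<pi> (B c \<times> UNIV) = (\<Sum>d\<in>S. \<pi> (B c \<times> B d))"
    and col: "\<pi> (UNIV \<times> B c) = (\<Sum>d\<in>S. \<pi> (B d \<times> B c))" for c
  proof -
    have "\<pi> (\<Union>d\<in>S. B c \<times> B d) = (\<Sum>d\<in>S. \<pi> (B c \<times> B d))"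
      by (rule vector_measure_UN[OF vm finS rect]) (auto simp: disjoint_family_on_def B_def)
    moreover have "(\<Union>d\<in>S. B c \<times> B d) = B c \<times> UNIV" using UB by auto
    ultimately show "\<pi> (B c \<times> UNIV) = (\<Sum>d\<in>S. \<pi> (B c \<times> B d))" by simp
    have "\<pi> (\<Union>d\<in>S. B d \<times> B c) = (\<Sum>d\<in>S. \<pi> (B d \<times> B c))"
      by (rule vector_measure_UN[OF vm finS rect]) (auto simp: disjoint_family_on_def B_def)
    moreover have "(\<Union>d\<in>S. B d \<times> B c) = UNIV \<times> B c" using UB by auto
    ultimately show "\<pi> (UNIV \<times> B c) = (\<Sum>d\<in>S. \<pi> (B d \<times> B c))" by simp
  qed
  have mass: "\<mu> (B c) = (\<Sum>d\<in>S. \<pi> (B c \<times> B d)) - (\<Sum>d\<in>S. \<pi> (B d \<times> B c))" for c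
    using \<pi> unfolding transports_def marginal1_def marginal2_def
    by (auto simp flip: row col)
  have bound: "norm (\<pi> C) \<le> measure (total_variation \<pi>) C" if "C \<in> sets borel" for C
    using norm_le_variation[OF that, of \<pi>]
    by (simp add: emeasure_total_variation[OF vm that, symmetric] emeasure_eq_measure)
  have int: "integrable (total_variation \<pi>) (\<lambda>z. norm (c - d) * indicator (B c \<times> B d) z)" for c d
    by (intro integrable_mult_right integrable_real_indicator) (simp_all add: less_top[symmetric])
  have "(\<Sum>c\<in>S. c \<bullet> \<mu> (B c)) = (\<Sum>c\<in>S. \<Sum>d\<in>S. c \<bullet> \<pi> (B c \<times> B d)) - (\<Sum>c\<in>S. \<Sum>d\<in>S. c \<bullet> \<pi> (B d \<times> B c))"
    by (simp add: mass inner_diff_right inner_sum_right sum_subtractf)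
  also have "(\<Sum>c\<in>S. \<Sum>d\<in>S. c \<bullet> \<pi> (B d \<times> B c)) = (\<Sum>c\<in>S. \<Sum>d\<in>S. d \<bullet> \<pi> (B c \<times> B d))"
    by (rule sum.swap)
  also have "(\<Sum>c\<in>S. \<Sum>d\<in>S. c \<bullet> \<pi> (B c \<times> B d)) - \<dots> = (\<Sum>c\<in>S. \<Sum>d\<in>S. (c - d) \<bullet> \<pi> (B c \<times> B d))"
    by (simp add: inner_diff_left sum_subtractf)
  also have "\<dots> \<le> (\<Sum>c\<in>S. \<Sum>d\<in>S. norm (c - d) * measure (total_variation \<pi>) (B c \<times> B d))"
    by (intro sum_mono order.trans[OF norm_cauchy_schwarz] mult_left_mono bound rect) auto
  also have "\<dots> = (\<Sum>c\<in>S. \<Sum>d\<in>S. \<integral>z. norm (c - d) * indicator (B c \<times> B d) z \<partial>total_variation \<pi>)"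
    by simp
  also have "\<dots> = (\<integral>z. (\<Sum>c\<in>S. \<Sum>d\<in>S. norm (c - d) * indicator (B c \<times> B d) z) \<partial>total_variation \<pi>)"
    by (simp only: Bochner_Integration.integral_sum Bochner_Integration.integrable_sum int)
  also have "\<dots> = (\<integral>z. norm (s (fst z) - s (snd z)) \<partial>total_variation \<pi>)"
  proof (intro Bochner_Integration.integral_cong refl)
    fix z
    have *: "norm (c - d) * indicat_real (B c \<times> B d) z
        = (if d = s (snd z) then (if c = s (fst z) then norm (c - d) else 0) else 0)" for c d
      by (cases z) (auto simp: indicator_def B_def)
    have "s (fst z) \<in> S" "s (snd z) \<in> S" by (auto simp: S_def)
    then show "(\<Sum>c\<in>S. \<Sum>d\<in>S. norm (c - d) * indicator (B c \<times> B d) z) = norm (s (fst z) - s (snd z))"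
      unfolding * using finS by (simp add: sum.delta)
  qed
  finally show ?thesis by (simp add: S_def B_def)
qed

text \<open>
  Approximation by simple functions and dominated convergence on both sides. On the right the
  constant functions are integrable because vector measures have finite variation.
\<close>

lemma weak_duality:
  fixes \<pi> :: "((real ^ 'n::finite) \<times> (real ^ 'n)) set \<Rightarrow> real ^ 'm::finite"
  assumes M: "sets M = sets borel" and f: "integrable M f"
    and \<pi>: "\<pi> \<in> transports (pushforward M (\<lambda>x. x) f)"
    and v [measurable]: "v \<in> borel_measurable borel" and bound: "\<And>x. norm (v x) \<le> K"
  shows "(\<integral>x. v x \<bullet> f x \<partial>M) \<le> (\<integral>z. norm (v (fst z) - v (snd z)) \<partial>total_variation \<pi>)"
proof -
  have vm: "vector_measure \<pi>" using \<pi> by (simp add: transports_def)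
  interpret finite_measure "total_variation \<pi>" by (rule finite_measure_total_variation[OF vm])
  note [measurable_cong] = M
  have [measurable]: "f \<in> borel_measurable borel"
    using borel_measurable_integrable[OF f] unfolding measurable_cong_sets[OF M refl] .
  have id: "(\<lambda>x. x) \<in> measurable M borel" by (simp add: measurable_def M sets_eq_imp_space_eq[OF M])
  obtain F where F: "\<And>i. simple_function borel (F i)" "\<And>x. (\<lambda>i. F i x) \<longlonglongrightarrow> v x"
      "\<And>i x. norm (F i x) \<le> 2 * norm (v x)"
    using borel_measurable_implies_sequence_metric[OF v, of 0]
    unfolding dist_0_norm dist_norm diff_0_right space_borel by blast
  have Fm [measurable]: "F i \<in> borel_measurable borel" for i
    using F(1) by (rule borel_measurable_simple_function)
  have FK: "norm (F i x) \<le> 2 * K" for i x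
    using F(3)[of i x] bound[of x] by simp
  have fin: "finite (range (F i))" for i using F(1)[of i] by (simp add: simple_function_def)
  have pre: "F i -` {c} \<in> sets borel" for i c
    using measurable_sets[OF Fm, of "{c}" i] by simp
  have step: "(\<integral>x. F i x \<bullet> f x \<partial>M) \<le> (\<integral>z. norm (F i (fst z) - F i (snd z)) \<partial>total_variation \<pi>)" for i
  proof -
    have "(\<integral>x. F i x \<bullet> f x \<partial>M) = (\<integral>x. (\<Sum>c\<in>range (F i). c \<bullet> (indicat_real (F i -` {c}) x *\<^sub>R f x)) \<partial>M)"
    proof (intro Bochner_Integration.integral_cong refl)
      fix x
      have *: "c \<bullet> (indicat_real (F i -` {c}) x *\<^sub>R f x) = (if c = F i x then c \<bullet> f x else 0)" for c
        by (auto simp: indicator_def)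
      show "F i x \<bullet> f x = (\<Sum>c\<in>range (F i). c \<bullet> (indicat_real (F i -` {c}) x *\<^sub>R f x))"
        unfolding * using fin by (simp add: sum.delta)
    qed
    also have "\<dots> = (\<Sum>c\<in>range (F i). c \<bullet> pushforward M (\<lambda>x. x) f (F i -` {c}))"
      unfolding pushforward_def using integrable_pushforward[OF id f pre]
      by (subst Bochner_Integration.integral_sum) (simp_all del: inner_scaleR_right)
    also have "\<dots> \<le> (\<integral>z. norm (F i (fst z) - F i (snd z)) \<partial>total_variation \<pi>)"
      by (rule weak_duality_simple[OF \<pi> Fm fin])
    finally show ?thesis .
  qed
  show ?thesis
  proof (rule LIMSEQ_le[OF _ _ exI, OF _ _ allI, OF _ _ impI])
    show "(\<lambda>i. \<integral>x. F i x \<bullet> f x \<partial>M) \<longlonglongrightarrow> (\<integral>x. v x \<bullet> f x \<partial>M)"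
    proof (rule integral_dominated_convergence[where w = "\<lambda>x. 2 * K * norm (f x)"])
      show "AE x in M. norm (F i x \<bullet> f x) \<le> 2 * K * norm (f x)" for i
      proof (rule AE_I2)
        fix x
        have "norm (F i x \<bullet> f x) \<le> norm (F i x) * norm (f x)"
          by (simp add: Cauchy_Schwarz_ineq2)
        also have "\<dots> \<le> 2 * K * norm (f x)" by (intro mult_right_mono FK norm_ge_zero)
        finally show "norm (F i x \<bullet> f x) \<le> 2 * K * norm (f x)" .
      qed
      show "AE x in M. (\<lambda>i. F i x \<bullet> f x) \<longlonglongrightarrow> v x \<bullet> f x"
        by (intro AE_I2 tendsto_intros F(2))
      show "integrable M (\<lambda>x. 2 * K * norm (f x))" using f by simp
    qed measurable
    show "(\<lambda>i. \<integral>z. norm (F i (fst z) - F i (snd z)) \<partial>total_variation \<pi>)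
        \<longlonglongrightarrow> (\<integral>z. norm (v (fst z) - v (snd z)) \<partial>total_variation \<pi>)"
    proof (rule integral_dominated_convergence[where w = "\<lambda>_. 4 * K"])
      show "AE z in total_variation \<pi>. norm (norm (F i (fst z) - F i (snd z))) \<le> 4 * K" for i
      proof (rule AE_I2)
        fix z
        show "norm (norm (F i (fst z) - F i (snd z))) \<le> 4 * K"
          using norm_triangle_ineq4[of "F i (fst z)" "F i (snd z)"] FK[of i "fst z"] FK[of i "snd z"] by simp
      qed
      show "AE z in total_variation \<pi>. (\<lambda>i. norm (F i (fst z) - F i (snd z)))
          \<longlonglongrightarrow> norm (v (fst z) - v (snd z))"
        by (intro AE_I2 tendsto_intros F(2))
    qed simp_all
  qed (rule step)
qed

text \<open>
  The middle term is kept because equality with a finite cost forces the variation of \<open>\<pi>\<close> onto the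
  pairs on which \<open>v\<close> is isometric.
\<close>

lemma weak_duality_Lipschitz:
  fixes \<pi> :: "((real ^ 'n::finite) \<times> (real ^ 'n)) set \<Rightarrow> real ^ 'm::finite"
  assumes M: "sets M = sets borel" and f: "integrable M f"
    and \<pi>: "\<pi> \<in> transports (pushforward M (\<lambda>x. x) f)"
    and v: "1-lipschitz_on UNIV v" and bound: "\<And>x. norm (v x) \<le> K"
  shows "ennreal (\<integral>x. v x \<bullet> f x \<partial>M)
      \<le> (\<integral>\<^sup>+z. ennreal (norm (v (fst z) - v (snd z))) \<partial>total_variation \<pi>)" (is "?l \<le> ?m")
    and "(\<integral>\<^sup>+z. ennreal (norm (v (fst z) - v (snd z))) \<partial>total_variation \<pi>) \<le> transport_cost \<pi>"
proof -
  have vm: "vector_measure \<pi>" using \<pi> by (simp add: transports_def)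
  interpret finite_measure "total_variation \<pi>" by (rule finite_measure_total_variation[OF vm])
  have v' [measurable]: "v \<in> borel_measurable borel"
    using v lipschitz_on_continuous_on borel_measurable_continuous_onI by blast
  have "integrable (total_variation \<pi>) (\<lambda>z. norm (v (fst z) - v (snd z)))"
  proof (rule integrable_const_bound[where B = "2 * K"])
    show "AE z in total_variation \<pi>. norm (norm (v (fst z) - v (snd z))) \<le> 2 * K"
    proof (rule AE_I2)
      fix z
      show "norm (norm (v (fst z) - v (snd z))) \<le> 2 * K"
        using norm_triangle_ineq4[of "v (fst z)" "v (snd z)"] bound[of "fst z"] bound[of "snd z"] by simp
    qed
  qed simp
  then have "?m = ennreal (\<integral>z. norm (v (fst z) - v (snd z)) \<partial>total_variation \<pi>)"
    by (intro nn_integral_eq_integral) auto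
  then show "?l \<le> ?m"
    using weak_duality[OF M f \<pi> v' bound] by (simp add: ennreal_leI)
  show "?m \<le> transport_cost \<pi>"
    unfolding transport_cost_def
    using lipschitz_onD[OF v] by (intro nn_integral_mono) (auto simp: dist_norm intro!: ennreal_leI)
qed

section \<open>A strictly contracting potential\<close>

text \<open>
  For \<open>b \<noteq> c\<close> this is the unit circle in a coordinate plane of the target. Two distinct indices
  exist because the target has dimension at least two.
\<close>

definition circle :: "'m \<Rightarrow> 'm \<Rightarrow> real \<Rightarrow> real ^ 'm::finite" where
  "circle b c t = cos t *\<^sub>R axis b 1 + sin t *\<^sub>R axis c 1"

lemma inner_circle: "b \<noteq> c \<Longrightarrow> circle b c s \<bullet> circle b c t = cos (s - t)"
  by (simp add: circle_def inner_add_left inner_add_right inner_axis_axis cos_diff)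

lemma norm_circle: "b \<noteq> c \<Longrightarrow> norm (circle b c t) = 1"
  by (simp add: norm_eq_sqrt_inner inner_circle)

lemma continuous_on_circle [continuous_intros]:
  fixes f :: "'a::t2_space \<Rightarrow> real"
  shows "continuous_on S f \<Longrightarrow> continuous_on S (\<lambda>x. circle b c (f x))"
  unfolding circle_def by (intro continuous_intros)

lemma abs_sin_less:
  fixes x :: real
  assumes "x \<noteq> 0"
  shows "\<bar>sin x\<bar> < \<bar>x\<bar>"
proof -
  have "\<bar>sin y\<bar> < y" if "0 < y" for y :: real
  proof (cases "y \<le> 1")
    case True
    have half: "sin (y / 2) > 0" and "sin y > 0"
      using that True pi_gt3 by (auto intro!: sin_gt_zero)
    have "cos (y / 2) < 1"
      using cos_monotone_0_pi[of 0 "y / 2"] that True pi_gt3 by simp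
    then have "sin (y / 2) * cos (y / 2) < sin (y / 2)" using half by simp
    moreover have "sin y = 2 * sin (y / 2) * cos (y / 2)" using sin_double[of "y / 2"] by simp
    moreover have "sin (y / 2) \<le> y / 2" using that by (intro sin_x_le_x) simp
    ultimately show ?thesis using \<open>sin y > 0\<close> by linarith
  next
    case False
    then show ?thesis using abs_sin_le_one[of y] by linarith
  qed
  from this[of x] this[of "- x"] assms show ?thesis by (cases "0 < x") auto
qed

text \<open>
  The length of a chord. It is strictly shorter than the arc, which is the source of all
  strictness below.
\<close>

lemma norm_circle_diff:
  assumes "b \<noteq> c"
  shows "norm (circle b c s - circle b c t) = 2 * \<bar>sin ((s - t) / 2)\<bar>"
proof -
  have "(norm (circle b c s - circle b c t))\<^sup>2 = 2 - 2 * cos (s - t)"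
    unfolding power2_norm_eq_inner
    by (simp add: inner_diff_left inner_diff_right inner_circle[OF assms] cos_diff)
  also have "\<dots> = (2 * \<bar>sin ((s - t) / 2)\<bar>)\<^sup>2"
  proof -
    define d where "d = (s - t) / 2"
    have "s - t = 2 * d" by (simp add: d_def)
    then have "cos (s - t) = 1 - 2 * (sin d)\<^sup>2" by (simp only: cos_double_sin)
    then show ?thesis unfolding d_def[symmetric] by (simp add: power_mult_distrib)
  qed
  finally show ?thesis by (subst (asm) power2_eq_iff_nonneg) auto
qed

text \<open>
  The coordinate \<open>a\<close> is the direction of transport. It is half open at \<open>pi\<close>, so that it splits
  into \<open>k\<close> half-open intervals of length \<open>pi / k\<close>; the other coordinates only serve to make the
  set bounded.
\<close>

definition slab :: "'n::finite \<Rightarrow> (real ^ 'n) set" where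
  "slab a = {x. 0 \<le> x $ a \<and> x $ a < pi \<and> (\<forall>i. i \<noteq> a \<longrightarrow> 0 \<le> x $ i \<and> x $ i \<le> 1)}"

definition slab_corner :: "'n \<Rightarrow> real ^ 'n::finite" where
  "slab_corner a = (\<chi> i. if i = a then pi else 1)"

lemma slab_subset: "slab a \<subseteq> cbox 0 (slab_corner a)"
  by (auto simp: slab_def slab_corner_def mem_box_cart)

lemma borel_measurable_vec_nth [measurable]: "(\<lambda>x :: real ^ 'n. x $ i) \<in> borel_measurable borel"
  by (intro borel_measurable_continuous_onI continuous_intros)

lemma slab_borel [measurable]: "slab a \<in> sets borel"
proof -
  have "{x \<in> space borel. 0 \<le> x $ a \<and> x $ a < pi \<and> (\<forall>i. i \<noteq> a \<longrightarrow> 0 \<le> x $ i \<and> x $ i \<le> 1)} \<in> sets borel"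
    by measurable
  then show ?thesis by (simp add: slab_def)
qed

lemma emeasure_slab: "emeasure lborel (slab a) < \<infinity>"
  by (rule emeasure_bounded_finite) (rule bounded_subset[OF bounded_cbox slab_subset])

lemma integrable_on_slab:
  fixes f :: "real ^ 'n::finite \<Rightarrow> 'b::{banach, second_countable_topology}"
  assumes f: "f \<in> borel_measurable borel" and bound: "\<And>x. x \<in> slab a \<Longrightarrow> norm (f x) \<le> K"
  shows "integrable lborel (\<lambda>x. indicator (slab a) x *\<^sub>R f x)"
proof (rule Bochner_Integration.integrable_bound)
  show "integrable lborel (\<lambda>x. indicator (slab a) x *\<^sub>R K)"
    using emeasure_slab[of a] by (intro integrable_scaleR_left integrable_real_indicator) auto
  show "AE x in lborel. norm (indicat_real (slab a) x *\<^sub>R f x) \<le> norm (indicat_real (slab a) x *\<^sub>R K)"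
    using bound by (intro AE_I2) (auto simp: indicator_def intro: order.trans[OF _ abs_ge_self])
  show "(\<lambda>x. indicat_real (slab a) x *\<^sub>R f x) \<in> borel_measurable lborel"
    using f by measurable
qed

text \<open>
  One full turn of the circle along direction \<open>a\<close>, at twice the speed of the potential.
\<close>

definition circle_density :: "'n \<Rightarrow> 'm \<Rightarrow> 'm \<Rightarrow> real ^ 'n::finite \<Rightarrow> real ^ 'm::finite" where
  "circle_density a b c x = indicator (slab a) x *\<^sub>R circle b c (2 * x $ a)"

abbreviation circle_measure :: "'n \<Rightarrow> 'm \<Rightarrow> 'm \<Rightarrow> (real ^ 'n::finite) set \<Rightarrow> real ^ 'm::finite" where
  "circle_measure a b c \<equiv> pushforward lborel (\<lambda>x. x) (circle_density a b c)"

text \<open>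
  The quarter turn makes the inner product with the density equal to the sine of the coordinate,
  which is nonnegative on the slab.
\<close>

definition potential :: "'n \<Rightarrow> 'm \<Rightarrow> 'm \<Rightarrow> real ^ 'n::finite \<Rightarrow> real ^ 'm::finite" where
  "potential a b c x = circle b c (x $ a + pi / 2)"

text \<open>
  For \<open>h = pi / k\<close> this is the sum of \<open>circle_density\<close> over the points \<open>x\<close>, \<open>x - h\<close>, \<open>x - 2 h\<close>, \<dots>
  of the slab (shifts in direction \<open>a\<close>), that is, the mass that has to pass from \<open>x\<close> to \<open>x + h\<close>.
  The sum is geometric, and this is its closed form; the floor is the number of shifts.
\<close>

definition flow :: "'n \<Rightarrow> 'm \<Rightarrow> 'm \<Rightarrow> real \<Rightarrow> real ^ 'n::finite \<Rightarrow> real ^ 'm::finite" where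
  "flow a b c h x = indicator (slab a) x *\<^sub>R
     (sin (of_int (\<lfloor>x $ a / h\<rfloor> + 1) * h) / sin h) *\<^sub>R circle b c (2 * x $ a - of_int \<lfloor>x $ a / h\<rfloor> * h)"

lemma potential_strict_contraction:
  fixes x y :: "real ^ 'n::finite"
  assumes "b \<noteq> c" "x \<noteq> y"
  shows "norm (potential a b c x - potential a b c y) < norm (x - y)"
proof (cases "x $ a = y $ a")
  case True
  then show ?thesis using assms by (simp add: potential_def)
next
  case False
  then have "norm (potential a b c x - potential a b c y) < \<bar>x $ a - y $ a\<bar>"
    using abs_sin_less[of "(x $ a - y $ a) / 2"]
    by (simp add: potential_def norm_circle_diff[OF assms(1)])
  also have "\<dots> \<le> norm (x - y)" using component_le_norm_cart[of "x - y" a] by simp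
  finally show ?thesis .
qed

lemma potential_Lipschitz:
  fixes a :: "'n::finite" and b c :: "'m::finite"
  assumes "b \<noteq> c"
  shows "1-lipschitz_on UNIV (potential a b c)"
proof (rule lipschitz_onI)
  fix x y :: "real ^ 'n"
  show "dist (potential a b c x) (potential a b c y) \<le> 1 * dist x y"
    using potential_strict_contraction[OF assms, of x y a] by (cases "x = y") (auto simp: dist_norm)
qed simp

text \<open>
  As the potential contracts strictly, the condition on \<open>y\<close> only concerns \<open>y = x\<close>.
\<close>

lemma transport_set_potential:
  assumes "b \<noteq> c" "A \<in> sets borel"
  shows "transport_set (potential a b c) A"
  unfolding transport_set_def
  using assms potential_strict_contraction[OF assms(1), where a = a] by (metis less_irrefl)

lemma inner_potential_density:
  "b \<noteq> c \<Longrightarrow> potential a b c x \<bullet> circle_density a b c x = indicator (slab a) x * sin (x $ a)"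
  by (simp add: potential_def circle_density_def inner_circle sin_cos_eq algebra_simps)

lemma integrable_density:
  fixes a :: "'n::finite"
  assumes "b \<noteq> c"
  shows "integrable lborel (circle_density a b c)"
  unfolding circle_density_def
  by (rule integrable_on_slab[where K = 1])
     (auto simp: norm_circle[OF assms] intro!: borel_measurable_continuous_onI continuous_intros)

section \<open>Transport in small steps\<close>

text \<open>
  Moving the mass of density \<open>f\<close> by the vector \<open>p\<close> removes \<open>f x\<close> at \<open>x\<close> and deposits \<open>f (x - p)\<close>
  there.
\<close>

lemma shift_transports:
  fixes g :: "real ^ 'n::finite \<Rightarrow> real ^ 'm::finite"
  assumes f: "integrable lborel f" and g: "\<And>x. f x - f (x - p) = g x"
  shows "pushforward lborel (\<lambda>x. (x, x + p)) f \<in> transports (pushforward lborel (\<lambda>x. x) g)"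
    and "transport_cost (pushforward lborel (\<lambda>x. (x, x + p)) f)
      \<le> (\<integral>\<^sup>+x. ennreal (norm p * norm (f x)) \<partial>lborel)"
proof -
  have "(\<lambda>x. (x, x + p)) \<in> borel_measurable (borel :: (real ^ 'n) measure)"
    by (intro borel_measurable_continuous_onI continuous_intros)
  then have T: "(\<lambda>x. (x, x + p)) \<in> borel_measurable (lborel :: (real ^ 'n) measure)"
    by simp
  note f [simp]
  have [measurable]: "f \<in> borel_measurable borel" using borel_measurable_integrable[OF f] by simp
  show "pushforward lborel (\<lambda>x. (x, x + p)) f \<in> transports (pushforward lborel (\<lambda>x. x) g)"
    unfolding transports_def
  proof (intro CollectI conjI ballI vector_measure_pushforward T f)
    fix B :: "(real ^ 'n) set"
    assume [measurable]: "B \<in> sets borel"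
    have shift: "(\<integral>x. h (p + x) \<partial>lborel) = (\<integral>x. h x \<partial>lborel)"
      if "h \<in> borel_measurable borel" for h :: "real ^ 'n \<Rightarrow> real ^ 'm"
      using integral_distr[of "(+) p" lborel borel h] that by (simp add: lborel_distr_plus)
    have shifti: "integrable lborel (\<lambda>x. f (x - p))"
      using integrable_distr[of "(+) (- p)" lborel borel f] f by (simp add: lborel_distr_plus)
    have "marginal2 (pushforward lborel (\<lambda>x. (x, x + p)) f) B = (\<integral>x. indicator B (p + x) *\<^sub>R f (p + x - p) \<partial>lborel)"
      unfolding marginal2_def pushforward_def
      by (intro Bochner_Integration.integral_cong) (auto simp: indicator_def add.commute)
    also have "\<dots> = (\<integral>x. indicator B x *\<^sub>R f (x - p) \<partial>lborel)"
      by (rule shift[of "\<lambda>x. indicator B x *\<^sub>R f (x - p)"]) measurable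
    finally have m2: "marginal2 (pushforward lborel (\<lambda>x. (x, x + p)) f) B = (\<integral>x. indicator B x *\<^sub>R f (x - p) \<partial>lborel)" .
    have m1: "marginal1 (pushforward lborel (\<lambda>x. (x, x + p)) f) B = (\<integral>x. indicator B x *\<^sub>R f x \<partial>lborel)"
      unfolding marginal1_def pushforward_def
      by (intro Bochner_Integration.integral_cong) (auto simp: indicator_def)
    show "marginal1 (pushforward lborel (\<lambda>x. (x, x + p)) f) B - marginal2 (pushforward lborel (\<lambda>x. (x, x + p)) f) B
        = pushforward lborel (\<lambda>x. x) g B"
      unfolding m1 m2 pushforward_def
      by (subst Bochner_Integration.integral_diff[symmetric])
         (auto intro!: integrable_mult_indicator shifti simp: scaleR_diff_right[symmetric] g)
  qed
  have "transport_cost (pushforward lborel (\<lambda>x. (x, x + p)) f)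
      \<le> (\<integral>\<^sup>+x. ennreal (norm (f x)) * (case (x, x + p) of (x, y) \<Rightarrow> ennreal (norm (x - y))) \<partial>lborel)"
    unfolding transport_cost_def
    by (rule nn_integral_total_variation_pushforward_le[OF T f])
       (simp add: case_prod_beta)
  also have "\<dots> = (\<integral>\<^sup>+x. ennreal (norm p * norm (f x)) \<partial>lborel)"
    by (simp add: ennreal_mult' mult.commute)
  finally show "transport_cost (pushforward lborel (\<lambda>x. (x, x + p)) f)
      \<le> (\<integral>\<^sup>+x. ennreal (norm p * norm (f x)) \<partial>lborel)" .
qed

text \<open>
  For \<open>h = pi / k\<close> and natural \<open>j\<close>, the two terms are the diagonals from one vertex of a regular
  polygon with unit sides to two consecutive vertices, so they differ by a side.
\<close>

lemma chord_telescope: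
  assumes bc: "b \<noteq> c" and h: "sin h \<noteq> 0"
  shows "(sin ((j + 1) * h) / sin h) *\<^sub>R circle b c (2 * t - j * h)
     - (sin (j * h) / sin h) *\<^sub>R circle b c (2 * (t - h) - (j - 1) * h) = circle b c (2 * t)"
proof -
  define w where "w = 2 * t - j * h"
  have eq: "2 * (t - h) - (j - 1) * h = w - h" "2 * t = w + j * h" "(j + 1) * h = j * h + h"
    by (simp_all add: w_def algebra_simps)
  have "sin (j * h + h) * cos w - sin (j * h) * cos (w - h) = sin h * cos (w + j * h)"
    "sin (j * h + h) * sin w - sin (j * h) * sin (w - h) = sin h * sin (w + j * h)"
    by (simp_all add: sin_add cos_add sin_diff cos_diff algebra_simps)
  then have "sin (j * h + h) / sin h * cos w - sin (j * h) / sin h * cos (w - h) = cos (w + j * h)"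
    "sin (j * h + h) / sin h * sin w - sin (j * h) / sin h * sin (w - h) = sin (w + j * h)"
    using h by (simp_all add: divide_simps mult.commute)
  then show ?thesis
    unfolding eq w_def[symmetric]
    by (simp add: circle_def algebra_simps flip: scaleR_diff_left scaleR_left_diff_distrib)
qed

text \<open>
  Inside the slab consecutive partial sums differ by the last summand. With \<open>j\<close> the floor in
  \<open>flow\<close>, a point that has no predecessor in the slab lies in the first layer, where \<open>sin (j * h)\<close>
  vanishes because \<open>j = 0\<close>. Nothing leaves the slab through its top, where \<open>j = k\<close> and
  \<open>k * h = pi\<close>: the density adds up to zero over the vertices of a regular polygon.
\<close>

lemma flow_balance:
  fixes x :: "real ^ 'n::finite"
  assumes bc: "b \<noteq> c" and k: "k \<ge> 2" and h: "h = pi / real k"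
  shows "flow a b c h x - flow a b c h (x - axis a h) = circle_density a b c x"
proof -
  have hpos: "0 < h" "h < pi" using k by (auto simp: h field_simps)
  then have sin: "sin h > 0" by (rule sin_gt_zero)
  have kh: "real k * h = pi" using k by (simp add: h)
  define y where "y = x - axis a h"
  define j where "j = \<lfloor>x $ a / h\<rfloor>"
  have ya: "y $ a = x $ a - h" and yi: "\<And>i. i \<noteq> a \<Longrightarrow> y $ i = x $ i"
    by (simp_all add: y_def axis_def)
  have jy: "\<lfloor>y $ a / h\<rfloor> = j - 1"
    using hpos by (simp add: ya j_def diff_divide_distrib)
  note tel = chord_telescope[OF bc, of h "of_int j" "x $ a"]
  have fy: "flow a b c h y = indicator (slab a) y *\<^sub>R
     (sin (of_int j * h) / sin h) *\<^sub>R circle b c (2 * (x $ a - h) - (of_int j - 1) * h)"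
    unfolding flow_def jy by (simp add: ya)
  have fx: "flow a b c h x = indicator (slab a) x *\<^sub>R
     (sin ((of_int j + 1) * h) / sin h) *\<^sub>R circle b c (2 * x $ a - of_int j * h)"
    unfolding flow_def j_def[symmetric] by simp
  consider "x \<in> slab a" "y \<in> slab a" | "x \<in> slab a" "y \<notin> slab a"
    | "x \<notin> slab a" "y \<in> slab a" | "x \<notin> slab a" "y \<notin> slab a"
    by blast
  then have "flow a b c h x - flow a b c h y = circle_density a b c x"
  proof cases
    case 1
    then show ?thesis using tel sin by (simp add: fx fy circle_density_def)
  next
    case 2
    then have "0 \<le> x $ a" "x $ a < h"
      using hpos yi by (auto simp: slab_def ya not_less not_le)
    then have "j = 0" using hpos by (simp add: j_def floor_eq_iff)
    then show ?thesis using 2 tel sin by (simp add: fx fy circle_density_def)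
  next
    case 3
    then have xa: "pi \<le> x $ a" "x $ a < pi + h"
      using hpos yi by (auto simp: slab_def ya not_less not_le)
    have "j = int k"
      unfolding j_def floor_eq_iff using xa hpos kh by (simp add: field_simps)
    then have "sin (of_int j * h) = 0" using kh by simp
    then show ?thesis using 3 by (simp add: fx fy circle_density_def)
  next
    case 4
    then show ?thesis by (simp add: fx fy circle_density_def)
  qed
  then show ?thesis by (simp add: y_def)
qed

text \<open>
  The sine in \<open>flow\<close> is taken at a multiple of \<open>h\<close> within distance \<open>h\<close> of the coordinate \<open>x $ a\<close>,
  and sine does not increase distances.
\<close>

lemma norm_flow_le:
  assumes bc: "b \<noteq> c" and h: "0 < h" "h < pi"
  shows "norm (flow a b c h x) \<le> indicator (slab a) x * ((sin (x $ a) + h) / sin h)"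
proof (cases "x \<in> slab a")
  case True
  define s where "s = (of_int \<lfloor>x $ a / h\<rfloor> + 1) * h"
  have "of_int \<lfloor>x $ a / h\<rfloor> \<le> x $ a / h" "x $ a / h < of_int \<lfloor>x $ a / h\<rfloor> + 1" by linarith+
  then have "of_int \<lfloor>x $ a / h\<rfloor> * h \<le> x $ a" "x $ a < (of_int \<lfloor>x $ a / h\<rfloor> + 1) * h"
    using h by (simp_all only: pos_le_divide_eq pos_divide_less_eq)
  then have "\<bar>s - x $ a\<bar> \<le> h" by (simp add: s_def algebra_simps)
  moreover have "\<bar>sin s - sin (x $ a)\<bar> \<le> \<bar>s - x $ a\<bar>"
  proof -
    have "\<bar>sin s - sin (x $ a)\<bar> = 2 * \<bar>sin ((s - x $ a) / 2)\<bar> * \<bar>cos ((s + x $ a) / 2)\<bar>"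
      by (simp add: sin_diff_sin abs_mult)
    also have "\<dots> \<le> 2 * \<bar>(s - x $ a) / 2\<bar> * 1"
      by (intro mult_mono abs_sin_x_le_abs_x abs_cos_le_one mult_left_mono) auto
    finally show ?thesis by simp
  qed
  moreover have "0 \<le> sin (x $ a)" using True by (intro sin_ge_zero) (auto simp: slab_def)
  ultimately have "\<bar>sin s\<bar> \<le> sin (x $ a) + h" by linarith
  moreover have "sin h > 0" using h by (rule sin_gt_zero)
  ultimately show ?thesis
    using True by (simp add: flow_def norm_circle[OF bc] s_def[symmetric] divide_right_mono)
qed (simp add: flow_def)

lemma integrable_flow:
  fixes a :: "'n::finite"
  assumes bc: "b \<noteq> c" and h: "0 < h" "h < pi"
  shows "integrable lborel (flow a b c h)"
proof -
  have *: "flow a b c h x = indicator (slab a) x *\<^sub>R flow a b c h x" for x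
    by (simp add: flow_def indicator_def)
  have sinh: "sin h > 0" using h by (rule sin_gt_zero)
  have "(\<lambda>t. circle b c t) \<in> borel_measurable borel"
    by (intro borel_measurable_continuous_onI continuous_intros)
  note [measurable] = this
  have m: "flow a b c h \<in> borel_measurable borel"
    unfolding flow_def by measurable
  have "norm (flow a b c h x) \<le> (1 + h) / sin h" if "x \<in> slab a" for x
    using norm_flow_le[OF bc h, of a x] that sinh
    by (auto elim!: order.trans intro!: divide_right_mono)
  then show ?thesis
    using integrable_on_slab[OF m] by (subst *[abs_def]) blast
qed

text \<open>
  The integral of \<open>potential\<close> against \<open>circle_density\<close>, in the form that shows its sign.
\<close>

definition dual_value :: "'n::finite \<Rightarrow> real" where
  "dual_value a = (\<integral>x. indicator (slab a) x * sin (x $ a) \<partial>lborel)"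

lemma integrable_sin_slab: "integrable lborel (\<lambda>x :: real ^ 'n. indicator (slab a) x * sin (x $ a))"
  using integrable_on_slab[of "\<lambda>x. sin (x $ a)" a 1]
  by (auto intro!: borel_measurable_continuous_onI continuous_intros)

lemma sin_slab_nonneg: "0 \<le> indicator (slab a) x * sin (x $ a)"
  by (auto simp: indicator_def slab_def intro!: sin_ge_zero)

lemma dual_value_pos: "0 < dual_value (a :: 'n::finite)"
proof -
  let ?f = "\<lambda>x :: real ^ 'n. indicator (slab a) x * sin (x $ a)"
  have "dual_value a \<noteq> 0"
  proof
    assume "dual_value a = 0"
    then have AE: "AE x in lborel. ?f x = 0"
      unfolding dual_value_def
      using integral_nonneg_eq_0_iff_AE[OF integrable_sin_slab, of a] sin_slab_nonneg by auto
    let ?B = "box 0 (slab_corner a)"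
    have pos: "?f x \<noteq> 0" if "x \<in> ?B" for x
    proof -
      have x: "0 < x $ i" "x $ i < (if i = a then pi else 1)" for i
        using that by (auto simp: mem_box_cart slab_corner_def)
      then have "x \<in> slab a"
        using x(1,2)[of a] by (auto simp: slab_def less_imp_le) (metis less_imp_le x)+
      moreover have "sin (x $ a) > 0" using x[of a] by (intro sin_gt_zero) auto
      ultimately show ?thesis by simp
    qed
    have "AE x in lborel. x \<notin> ?B"
      using AE by eventually_elim (use pos in blast)
    then have "?B \<in> null_sets lborel"
      by (subst (asm) AE_iff_null_sets[symmetric]) auto
    then have "negligible ?B"
      using null_sets_completionI[of ?B lborel] by (simp add: negligible_iff_null_sets)
    moreover have "(slab_corner a /\<^sub>R 2) \<in> ?B"
      by (auto simp: mem_box_cart slab_corner_def)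
    ultimately show False using open_not_negligible[OF open_box, of 0 "slab_corner a"] by auto
  qed
  moreover have "0 \<le> dual_value a" 
    unfolding dual_value_def by (intro integral_nonneg_AE AE_I2 sin_slab_nonneg)
  ultimately show ?thesis by simp
qed

text \<open>
  The flows with step \<open>h = pi / k\<close> cost at most \<open>h / sin h * (dual_value a + h * L)\<close>, where \<open>L\<close> is
  the volume of the slab, and this tends to the dual value as \<open>h\<close> tends to zero.
\<close>

lemma wasserstein_norm_le_dual_value:
  fixes a :: "'n::finite" and b c :: "'m::finite"
  assumes bc: "b \<noteq> c"
  shows "wasserstein_norm (circle_measure a b c) \<le> ennreal (dual_value a)"
proof (rule LIMSEQ_le_const)
  define L where "L = measure lborel (slab a)"
  let ?c = "\<lambda>k. (pi / real k) / sin (pi / real k) * (dual_value a + pi / real k * L)"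
  have "?c \<longlonglongrightarrow> dual_value a" by real_asymp
  then show "(\<lambda>k. ennreal (?c k)) \<longlonglongrightarrow> ennreal (dual_value a)" by (rule tendsto_ennrealI)
  have "wasserstein_norm (circle_measure a b c) \<le> ennreal (?c k)" if k: "k \<ge> 2" for k
  proof -
    define h where "h = pi / real k"
    have h: "0 < h" "h < pi" using k by (auto simp: h_def field_simps)
    have sinh: "sin h > 0" using h by (rule sin_gt_zero)
    have intL: "integrable lborel (indicat_real (slab a))"
      using emeasure_slab[of a] by (intro integrable_real_indicator) auto
    note fl = integrable_flow[OF bc h, of a]
    have bal: "flow a b c h x - flow a b c h (x - axis a h) = circle_density a b c x" for x
      by (rule flow_balance[OF bc k h_def])
    note tr = shift_transports[OF fl bal]
    have "wasserstein_norm (circle_measure a b c)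
        \<le> (\<integral>\<^sup>+x. ennreal (norm (axis a h :: real ^ 'n) * norm (flow a b c h x)) \<partial>lborel)"
      unfolding wasserstein_norm_def by (rule order.trans[OF INF_lower[OF tr(1), where f = transport_cost] tr(2)])
    also have "\<dots> \<le> (\<integral>\<^sup>+x. ennreal (h / sin h * (indicator (slab a) x * sin (x $ a) + h * indicator (slab a) x)) \<partial>lborel)"
    proof (intro nn_integral_mono ennreal_leI)
      fix x :: "real ^ 'n"
      have "h * norm (flow a b c h x) \<le> h * (indicator (slab a) x * ((sin (x $ a) + h) / sin h))"
        using h by (intro mult_left_mono norm_flow_le[OF bc]) auto
      also have "\<dots> = h / sin h * (indicator (slab a) x * sin (x $ a) + h * indicator (slab a) x)"
        by (simp add: field_simps)
      finally show "norm (axis a h :: real ^ 'n) * norm (flow a b c h x)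
          \<le> h / sin h * (indicator (slab a) x * sin (x $ a) + h * indicator (slab a) x)"
        using h by (simp add: norm_eq_sqrt_inner inner_axis_axis)
    qed
    also have "\<dots> = ennreal (\<integral>x. h / sin h * (indicator (slab a) x * sin (x $ a) + h * indicator (slab a) x) \<partial>lborel)"
    proof (rule nn_integral_eq_integral)
      show "integrable lborel (\<lambda>x. h / sin h * (indicator (slab a) x * sin (x $ a) + h * indicator (slab a) x))"
        by (intro integrable_mult_right Bochner_Integration.integrable_add integrable_sin_slab intL)
      show "AE x in lborel. 0 \<le> h / sin h * (indicator (slab a) x * sin (x $ a) + h * indicator (slab a) x)"
        using h sinh by (intro AE_I2 mult_nonneg_nonneg[OF _ add_nonneg_nonneg] sin_slab_nonneg) auto
    qed
    also have "(\<integral>x. h / sin h * (indicator (slab a) x * sin (x $ a) + h * indicator (slab a) x) \<partial>lborel)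
        = h / sin h * (dual_value a + h * L)"
      by (simp add: integrable_sin_slab intL dual_value_def L_def)
    finally show ?thesis by (simp add: h_def)
  qed
  then show "\<exists>N. \<forall>k\<ge>N. wasserstein_norm (circle_measure a b c) \<le> ennreal (?c k)"
    by blast
qed

section \<open>Optimality and mass balance\<close>

lemma vector_integral_density:
  fixes a :: "'n::finite" and b c :: "'m::finite" and v :: "real ^ 'n \<Rightarrow> real ^ 'm"
  assumes bc: "b \<noteq> c" and v: "continuous_on UNIV v"
  shows "vector_integral (circle_measure a b c) v = (\<integral>x. v x \<bullet> circle_density a b c x \<partial>lborel)"
proof (rule vector_integral_pushforward)
  have vm: "v \<in> borel_measurable borel" using v by (rule borel_measurable_continuous_onI)
  then show "v \<in> borel_measurable lborel" by simp
  have "compact (v ` cbox 0 (slab_corner a))"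
    using v by (intro compact_continuous_image) (auto intro: continuous_on_subset)
  then obtain K where K: "\<And>x. x \<in> cbox 0 (slab_corner a) \<Longrightarrow> norm (v x) \<le> K"
    using compact_imp_bounded bounded_iff by (metis imageI)
  have "integrable lborel (\<lambda>x. indicator (slab a) x *\<^sub>R norm (v x))"
    using vm K slab_subset[of a] by (intro integrable_on_slab[where K = K]) auto
  moreover have "(\<lambda>x. norm (v x) * norm (circle_density a b c x)) = (\<lambda>x. indicator (slab a) x *\<^sub>R norm (v x))"
    by (auto simp: circle_density_def norm_circle[OF bc] indicator_def)
  ultimately show "integrable lborel (\<lambda>x. norm (v x) * norm (circle_density a b c x))" by simp
qed (use integrable_density[OF bc] in auto)

lemma vector_integral_potential:
  assumes bc: "b \<noteq> c"
  shows "vector_integral (circle_measure a b c) (potential a b c) = dual_value a"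
  using vector_integral_density[OF bc lipschitz_on_continuous_on[OF potential_Lipschitz[OF bc]], of a a]
  by (simp add: inner_potential_density[OF bc] dual_value_def)

text \<open>
  Weak duality is available for bounded maps. Composing \<open>v\<close> with the projection onto a box around
  the slab makes it bounded, keeps it \<open>1\<close>-Lipschitz and does not change its integral.
\<close>

lemma vector_integral_le_dual_value:
  fixes a :: "'n::finite" and b c :: "'m::finite" and v :: "real ^ 'n \<Rightarrow> real ^ 'm"
  assumes bc: "b \<noteq> c" and v: "1-lipschitz_on UNIV v"
  shows "vector_integral (circle_measure a b c) v \<le> dual_value a"
proof -
  define K where "K = cbox 0 (slab_corner a)"
  have "0 \<in> K" by (auto simp: K_def slab_corner_def mem_box_cart)
  then have K: "convex K" "closed K" "K \<noteq> {}" "compact K" by (auto simp: K_def)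
  define w where "w x = v (closest_point K x)" for x
  have w: "1-lipschitz_on UNIV w"
  proof (rule lipschitz_onI)
    fix x y
    show "dist (w x) (w y) \<le> 1 * dist x y"
      using lipschitz_onD[OF v, of "closest_point K x" "closest_point K y"]
        closest_point_lipschitz[OF K(1-3), of x y] by (simp add: w_def)
  qed simp
  have "compact (v ` K)"
    using lipschitz_on_continuous_on[OF v] K by (intro compact_continuous_image) (auto intro: continuous_on_subset)
  then obtain R where R: "\<And>x. x \<in> K \<Longrightarrow> norm (v x) \<le> R"
    using compact_imp_bounded bounded_iff by (metis imageI)
  have wR: "norm (w x) \<le> R" for x
    unfolding w_def by (rule R[OF closest_point_in_set[OF K(2,3)]])
  have "vector_integral (circle_measure a b c) v = (\<integral>x. v x \<bullet> circle_density a b c x \<partial>lborel)"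
    by (rule vector_integral_density[OF bc lipschitz_on_continuous_on[OF v]])
  also have "\<dots> = (\<integral>x. w x \<bullet> circle_density a b c x \<partial>lborel)"
    using slab_subset[of a]
    by (intro Bochner_Integration.integral_cong refl)
       (auto simp: circle_density_def indicator_def w_def K_def closest_point_self subset_iff)
  also have "ennreal \<dots> \<le> wasserstein_norm (circle_measure a b c)"
    unfolding wasserstein_norm_def
    by (intro INF_greatest order.trans[OF weak_duality_Lipschitz[OF sets_lborel integrable_density[OF bc] _ w wR]])
  also have "\<dots> \<le> ennreal (dual_value a)" by (rule wasserstein_norm_le_dual_value[OF bc])
  finally show ?thesis using dual_value_pos[of a] by (simp add: ennreal_le_iff)
qed

text \<open>
  By duality an optimal \<open>\<pi>\<close> would make both inequalities of weak duality for the potential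
  equalities. As the potential contracts strictly, the variation of \<open>\<pi>\<close> would be concentrated on
  the diagonal, and its cost would be zero.
\<close>

lemma no_optimal_transport:
  fixes a :: "'n::finite" and b c :: "'m::finite"
  assumes bc: "b \<noteq> c"
  shows "\<not> optimal_transport (circle_measure a b c) \<pi>"
proof
  assume opt: "optimal_transport (circle_measure a b c) \<pi>"
  define \<mu> where "\<mu> = circle_measure a b c"
  define u where "u = potential a b c"
  have \<pi>: "\<pi> \<in> transports \<mu>" and W: "wasserstein_norm \<mu> = transport_cost \<pi>"
    using opt by (auto simp: optimal_transport_def \<mu>_def)
  have u: "1-lipschitz_on UNIV u" unfolding u_def by (rule potential_Lipschitz[OF bc])
  have [measurable]: "u \<in> borel_measurable borel"
    using u lipschitz_on_continuous_on borel_measurable_continuous_onI by blast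
  have bound: "norm (u x) \<le> 1" for x by (simp add: u_def potential_def norm_circle[OF bc])
  let ?d = "\<lambda>z. ennreal (norm (fst z - snd z))" and ?e = "\<lambda>z. ennreal (norm (u (fst z) - u (snd z)))"
  have cost: "transport_cost \<pi> = (\<integral>\<^sup>+z. ?d z \<partial>total_variation \<pi>)"
    by (simp add: transport_cost_def case_prod_unfold)
  have "(\<integral>x. u x \<bullet> circle_density a b c x \<partial>lborel) = dual_value a"
    by (simp add: u_def inner_potential_density[OF bc] dual_value_def)
  then have lower: "ennreal (dual_value a) \<le> (\<integral>\<^sup>+z. ?e z \<partial>total_variation \<pi>)"
    and "(\<integral>\<^sup>+z. ?e z \<partial>total_variation \<pi>) \<le> transport_cost \<pi>"
    using weak_duality_Lipschitz[OF sets_lborel integrable_density[OF bc] \<pi>[unfolded \<mu>_def] u bound] by simp_all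
  moreover have upper: "transport_cost \<pi> \<le> ennreal (dual_value a)"
    using wasserstein_norm_le_dual_value[OF bc, of a] W by (simp add: \<mu>_def)
  ultimately have eq: "(\<integral>\<^sup>+z. ?e z \<partial>total_variation \<pi>) = (\<integral>\<^sup>+z. ?d z \<partial>total_variation \<pi>)"
    and fin: "(\<integral>\<^sup>+z. ?e z \<partial>total_variation \<pi>) \<noteq> \<infinity>"
    unfolding cost by (auto simp: top_unique)
  have "(\<integral>\<^sup>+z. ?d z - ?e z \<partial>total_variation \<pi>) = 0"
    using lipschitz_onD[OF u] fin eq
    by (subst nn_integral_diff) (auto simp: dist_norm intro!: ennreal_leI)
  then have "AE z in total_variation \<pi>. ?d z - ?e z = 0"
    by (subst (asm) nn_integral_0_iff_AE) auto
  then have "AE z in total_variation \<pi>. ?d z = 0"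
  proof eventually_elim
    case (elim z)
    have "fst z = snd z"
    proof (rule ccontr)
      assume "fst z \<noteq> snd z"
      then have "norm (u (fst z) - u (snd z)) < norm (fst z - snd z)"
        unfolding u_def by (rule potential_strict_contraction[OF bc])
      then show False using elim by (simp add: diff_eq_0_iff_ennreal)
    qed
    then show ?case by simp
  qed
  then have "transport_cost \<pi> = 0"
    unfolding cost by (subst nn_integral_0_iff_AE) auto
  then have "ennreal (dual_value a) \<le> 0" using lower eq cost by simp
  then show False using dual_value_pos[of a] by (simp add: ennreal_le_iff)
qed

text \<open>
  The total mass vanishes because a transport exists, and both marginals of a transport have the
  same total mass.
\<close>

lemma circle_density_in_wasserstein_space:
  fixes a :: "'n::finite" and b c :: "'m::finite"
  assumes bc: "b \<noteq> c"
  shows "circle_measure a b c \<in> wasserstein_space"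
proof -
  let ?\<mu> = "circle_measure a b c"
  have id: "(\<lambda>x. x) \<in> borel_measurable lborel" by simp
  note g = integrable_density[OF bc, of a]
  obtain R where R: "\<And>x. x \<in> cbox 0 (slab_corner a) \<Longrightarrow> norm x \<le> R"
    using bounded_cbox[of 0 "slab_corner a"] unfolding bounded_iff by blast
  have "integrable lborel (\<lambda>x. indicator (slab a) x *\<^sub>R norm x)"
  proof (rule integrable_on_slab)
    show "norm (norm x) \<le> R" if "x \<in> slab a" for x using slab_subset[of a] that R by auto
  qed simp
  then have "(\<integral>\<^sup>+x. ennreal (norm (indicator (slab a) x *\<^sub>R norm x)) \<partial>lborel) < \<infinity>"
    unfolding integrable_iff_bounded by blast
  moreover have "(\<integral>\<^sup>+x. ennreal (norm (x - 0)) \<partial>total_variation ?\<mu>)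
      \<le> (\<integral>\<^sup>+x. ennreal (norm (circle_density a b c x)) * ennreal (norm (x - 0)) \<partial>lborel)"
    by (rule nn_integral_total_variation_pushforward_le[OF id g]) simp
  moreover have "ennreal (norm (circle_density a b c x)) * ennreal (norm (x - 0))
      = ennreal (norm (indicator (slab a) x *\<^sub>R norm x))" for x
    by (auto simp: circle_density_def norm_circle[OF bc] indicator_def)
  ultimately have moment: "(\<integral>\<^sup>+x. ennreal (norm (x - 0)) \<partial>total_variation ?\<mu>) < \<infinity>"
    by simp
  have h: "0 < pi / real 2" "pi / real 2 < pi" by simp_all
  have "pushforward lborel (\<lambda>x. (x, x + axis a (pi / real 2))) (flow a b c (pi / real 2)) \<in> transports ?\<mu>"
    by (rule shift_transports[OF integrable_flow[OF bc h] flow_balance[OF bc order.refl refl]])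
  then have "?\<mu> UNIV = 0"
    by (auto simp: transports_def marginal1_def marginal2_def dest!: bspec[of _ _ UNIV])
  with moment show ?thesis
    unfolding wasserstein_space_def using vector_measure_pushforward[OF id g] by blast
qed

text \<open>
  If the measure vanished, the zero transport would be optimal.
\<close>

lemma circle_density_nonzero:
  fixes a :: "'n::finite" and b c :: "'m::finite"
  assumes bc: "b \<noteq> c"
  shows "\<exists>A \<in> sets borel. circle_measure a b c A \<noteq> 0"
proof (rule ccontr)
  let ?\<mu> = "circle_measure a b c"
  assume "\<not> ?thesis"
  then have zero: "?\<mu> A = 0" if "A \<in> sets borel" for A using that by blast
  define \<pi> where "\<pi> = pushforward lborel (\<lambda>x :: real ^ 'n. (x, x + 0)) (\<lambda>_. 0 :: real ^ 'm)"
  note tr = shift_transports[of "\<lambda>_ :: real ^ 'n. 0 :: real ^ 'm" 0 "\<lambda>_. 0", folded \<pi>_def]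
  have "\<pi> \<in> transports ?\<mu>"
    using tr(1) zero by (simp add: transports_def pushforward_def)
  moreover have "transport_cost \<pi> = 0" using tr(2) by simp
  ultimately have "optimal_transport ?\<mu> \<pi>"
    unfolding optimal_transport_def wasserstein_norm_def
    by (metis INF_lower le_zero_eq)
  then show False using no_optimal_transport[OF bc] by blast
qed

lemma optimal_potential_potential:
  fixes a :: "'n::finite" and b c :: "'m::finite"
  assumes bc: "b \<noteq> c"
  shows "optimal_potential (circle_measure a b c) (potential a b c)"
  unfolding optimal_potential_def
proof (intro conjI antisym SUP_least)
  show "1-lipschitz_on UNIV (potential a b c)" by (rule potential_Lipschitz[OF bc])
  then show "ereal (vector_integral (circle_measure a b c) (potential a b c))
      \<le> (SUP v \<in> {v. 1-lipschitz_on UNIV v}. ereal (vector_integral (circle_measure a b c) v))"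
    by (intro SUP_upper) simp
qed (simp add: vector_integral_potential[OF bc] vector_integral_le_dual_value[OF bc])

theorem theorem5:
  assumes "CARD('m::finite) > 1"
  shows "\<exists>\<mu> :: (real ^ 'n::finite) set \<Rightarrow> real ^ 'm.
    \<mu> \<in> wasserstein_space \<and>
    vector_absolutely_continuous lborel \<mu> \<and>
    (\<exists>u A. optimal_potential \<mu> u \<and> transport_set u A \<and> \<mu> A \<noteq> 0) \<and>
    \<not> (\<exists>\<pi>. optimal_transport \<mu> \<pi> \<and>
          absolutely_continuous lborel (distr (total_variation \<pi>) borel fst) \<and>
          absolutely_continuous lborel (distr (total_variation \<pi>) borel snd))"
proof -
  obtain b c :: 'm where bc: "b \<noteq> c"
    using assms card_le_Suc0_iff_eq[of "UNIV :: 'm set"] by auto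
  \<comment> \<open>any coordinate of the source can serve as the direction of transport\<close>
  define a :: 'n where "a = undefined"
  define \<mu> where "\<mu> = circle_measure a b c"
  have "vector_absolutely_continuous lborel \<mu>"
    unfolding vector_absolutely_continuous_def
  proof
    fix B :: "(real ^ 'n) set"
    assume "B \<in> null_sets lborel"
    then have "AE x in lborel. indicator B x *\<^sub>R circle_density a b c x = 0"
      by (rule AE_not_in[THEN eventually_mono]) simp
    then show "\<mu> B = 0"
      unfolding \<mu>_def pushforward_def by (rule integral_eq_zero_AE)
  qed
  moreover obtain A where "A \<in> sets borel" "\<mu> A \<noteq> 0"
    using circle_density_nonzero[OF bc, of a] unfolding \<mu>_def by blast
  ultimately show ?thesis
    using circle_density_in_wasserstein_space[OF bc, of a] optimal_potential_potential[OF bc, of a]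
      transport_set_potential[OF bc, of A a] no_optimal_transport[OF bc, of a]
    unfolding \<mu>_def by blast
qed

end
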